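(* Let $\Gamma$ be a distance-regular graph of diameter $4$ and valency $k\ge 3$ that is twice $Q$-polynomial, i.e. admits exactly two distinct $Q$-polynomial structures. Then for one of these two $Q$-polynomial structures $E_0,E_1,E_2,E_3,E_4$ the dual intersection numbers satisfy $a_1^*=a_2^*=a_3^*=0$; that is, this structure is either dual bipartite or almost dual bipartite.
   Context: Let $\Gamma$ be a finite connected simple graph with vertex set $X$, diameter $d$, that is distance-regular, with distance matrices $A_0=I,A_1=A,\dots,A_d$ spanning the Bose–Mesner algebra $M$. Let $E_0=|X|^{-1}J,E_1,\dots,E_d$ be the primitive idempotents of $M$. For a fixed ordering of the idempotents, the Krein parameters $q^k_{ij}\ge 0$ are defined by $E_i\circ E_j=|X|^{-1}\sum_{k=0}^d q^k_{ij}E_k$, where $\circ$ is the entrywise (Schur) product. An ordering $E_0,E_1,\dots,E_d$ (with $E_0=|X|^{-1}J$) is a $Q$-polynomial structure if for all $0\le h,i,j\le d$ we have $q^h_{ij}=0$ whenever one of $h,i,j$ exceeds the sum of the other two, and $q^h_{ij}\neq 0$ whenever one of $h,i,j$ equals the sum of the other two (equivalently, there is a sequence $\sigma_0,\dots,\sigma_d$ and polynomials $q_j$ of degree $j$ with $E_j=\sum_i q_j(\sigma_i)A_i$). For such a structure write $a_i^*=q^i_{1i}$ ($0\le i\le d$). The structure is called dual bipartite if $a_0^*=a_1^*=\dots=a_d^*=0$, and almost dual bipartite if $a_0^*=\dots=a_{d-1}^*=0\neq a_d^*$. A distance-regular graph is twice $Q$-polynomial if it has exactly two $Q$-polynomial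 structures. *)

theory Defs
  imports "HOL-Analysis.Analysis"
begin

definition is_walk :: "('n \<Rightarrow> 'n \<Rightarrow> bool) \<Rightarrow> (nat \<Rightarrow> 'n) \<Rightarrow> nat \<Rightarrow> 'n \<Rightarrow> 'n \<Rightarrow> bool" where
  "is_walk adj p n x y \<longleftrightarrow> p 0 = x \<and> p n = y \<and> (\<forall>i<n. adj (p i) (p (Suc i)))"

definition gdist :: "('n \<Rightarrow> 'n \<Rightarrow> bool) \<Rightarrow> 'n \<Rightarrow> 'n \<Rightarrow> nat" where
  "gdist adj x y = (LEAST n. \<exists>p. is_walk adj p n x y)"

definition simple_graph :: "('n \<Rightarrow> 'n \<Rightarrow> bool) \<Rightarrow> bool" where
  "simple_graph adj \<longleftrightarrow> (\<forall>x y. adj x y \<longrightarrow> adj y x) \<and> (\<forall>x. \<not> adj x x)"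

definition connected_graph :: "('n \<Rightarrow> 'n \<Rightarrow> bool) \<Rightarrow> bool" where
  "connected_graph adj \<longleftrightarrow> (\<forall>x y. \<exists>n p. is_walk adj p n x y)"

definition diameter :: "('n::finite \<Rightarrow> 'n \<Rightarrow> bool) \<Rightarrow> nat" where
  "diameter adj = Max {gdist adj x y | x y. True}"

definition regular_of_valency :: "('n::finite \<Rightarrow> 'n \<Rightarrow> bool) \<Rightarrow> nat \<Rightarrow> bool" where
  "regular_of_valency adj k \<longleftrightarrow> (\<forall>x. card {y. adj x y} = k)"

definition distance_regular :: "('n::finite \<Rightarrow> 'n \<Rightarrow> bool) \<Rightarrow> bool" where
  "distance_regular adj \<longleftrightarrow> simple_graph adj \<and> connected_graph adj \<and>
     (\<forall>x y x' y' i j. gdist adj x y = gdist adj x' y' \<longrightarrow>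
        card {z. gdist adj x z = i \<and> gdist adj y z = j} =
        card {z. gdist adj x' z = i \<and> gdist adj y' z = j})"

definition dist_mat :: "('n::finite \<Rightarrow> 'n \<Rightarrow> bool) \<Rightarrow> nat \<Rightarrow> real^'n^'n" where
  "dist_mat adj i = (\<chi> x y. if gdist adj x y = i then 1 else 0)"

definition hadamard :: "real^'n^'n \<Rightarrow> real^'n^'n \<Rightarrow> real^'n^'n" where
  "hadamard A B = (\<chi> x y. A $ x $ y * B $ x $ y)"

definition all_ones :: "real^'n^'n" where
  "all_ones = (\<chi> x y. 1)"

definition bose_mesner :: "('n::finite \<Rightarrow> 'n \<Rightarrow> bool) \<Rightarrow> (real^'n^'n) set" where
  "bose_mesner adj = {B. \<exists>c. B = (\<Sum>i\<le>diameter adj. c i *\<^sub>R dist_mat adj i)}"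

text \<open>An ordering E_0,...,E_d of the primitive idempotents of M with E_0 = |X|^-1 J
  (E k = 0 for k > d as normalisation): d+1 nonzero, pairwise orthogonal idempotents
  of M summing to I; since dim M = d+1 these are exactly the primitive idempotents.\<close>
definition idempotent_ordering :: "('n::finite \<Rightarrow> 'n \<Rightarrow> bool) \<Rightarrow> (nat \<Rightarrow> real^'n^'n) \<Rightarrow> bool" where
  "idempotent_ordering adj E \<longleftrightarrow>
     (\<forall>i\<le>diameter adj. E i \<in> bose_mesner adj \<and> E i \<noteq> 0) \<and>
     (\<forall>i\<le>diameter adj. \<forall>j\<le>diameter adj. E i ** E j = (if i = j then E i else 0)) \<and>
     (\<Sum>i\<le>diameter adj. E i) = mat 1 \<and>
     E 0 = (1 / real CARD('n)) *\<^sub>R all_ones \<and>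
     (\<forall>i>diameter adj. E i = 0)"

definition krein :: "('n::finite \<Rightarrow> 'n \<Rightarrow> bool) \<Rightarrow> (nat \<Rightarrow> real^'n^'n) \<Rightarrow> nat \<Rightarrow> nat \<Rightarrow> nat \<Rightarrow> real" where
  "krein adj E i j k = (THE q. (\<forall>l>diameter adj. q l = 0) \<and>
      hadamard (E i) (E j) = (1 / real CARD('n)) *\<^sub>R (\<Sum>l\<le>diameter adj. q l *\<^sub>R E l)) k"

definition Q_polynomial_structure :: "('n::finite \<Rightarrow> 'n \<Rightarrow> bool) \<Rightarrow> (nat \<Rightarrow> real^'n^'n) \<Rightarrow> bool" where
  "Q_polynomial_structure adj E \<longleftrightarrow> idempotent_ordering adj E \<and>
     (\<forall>h\<le>diameter adj. \<forall>i\<le>diameter adj. \<forall>j\<le>diameter adj.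
        ((h > i + j \<or> i > h + j \<or> j > h + i) \<longrightarrow> krein adj E i j h = 0) \<and>
        ((h = i + j \<or> i = h + j \<or> j = h + i) \<longrightarrow> krein adj E i j h \<noteq> 0))"

definition dual_a :: "('n::finite \<Rightarrow> 'n \<Rightarrow> bool) \<Rightarrow> (nat \<Rightarrow> real^'n^'n) \<Rightarrow> nat \<Rightarrow> real" where
  "dual_a adj E i = krein adj E 1 i i"

definition twice_Q_polynomial :: "('n::finite \<Rightarrow> 'n \<Rightarrow> bool) \<Rightarrow> bool" where
  "twice_Q_polynomial adj \<longleftrightarrow> card {E. Q_polynomial_structure adj E} = 2"

end

theory Submission
  imports Defs
begin

text \<open>
  Let \<open>E\<close> and \<open>F\<close> be the two structures. A Krein parameter of \<open>E\<close> vanishes exactly when the entrywise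
  triple product \<open>T i j h\<close> does, and then all triple sums
  \<open>\<Sum>z. E i z a * E j z b * E h z c\<close> vanish. The second structure is a permutation of the first, and the
  required (non)vanishing of Krein parameters leaves, up to exchanging \<open>E\<close> and \<open>F\<close>, only
  \<open>(0,2,4,3,1)\<close>, \<open>(0,3,2,1,4)\<close>, \<open>(0,3,4,1,2)\<close> and \<open>(0,4,2,3,1)\<close>.

  In the first three cases \<open>a\<^sub>2\<^sup>* = 0\<close> or \<open>a\<^sub>3\<^sup>* = 0\<close>. The triple sums then force \<open>a\<^sub>1\<^sup>* = 0\<close>, and the second
  Askey-Wilson relation of the Leonard system shows that \<open>a\<^sub>2\<^sup>*\<close> and \<open>a\<^sub>3\<^sup>*\<close> vanish together.

  In the last case Leonard's recurrences for both structures determine the intersection array in terms of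
  \<open>p = \<theta> 2\<close> and \<open>c\<^sub>2\<close>: \<open>a\<^sub>1 = c\<^sub>2 + p\<close>, \<open>b\<^sub>2 = p\<^sup>2\<close>, \<open>b\<^sub>3 = p\<^sup>2 / c\<^sub>2\<close>. Since \<open>E 1\<close> times \<open>E 4\<close> lies in \<open>E 3\<close>,
  three mutually adjacent vertices have \<open>N = a\<^sub>1 / (1 + p)\<close> common neighbours, so \<open>N\<close> is an integer.
  Divisibility of \<open>p\<^sup>2\<close> by \<open>c\<^sub>2\<close> leaves only \<open>N = p\<close> (the parameters of the Johnson graph \<open>J(8,4)\<close> for
  \<open>p = 2\<close>), where a cosine vanishes at distance two, which the nonzero Krein parameters forbid.
\<close>

section \<open>Distance-regular graphs\<close>

locale drg =
  fixes adj :: "'n::finite \<Rightarrow> 'n \<Rightarrow> bool"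
  assumes drg: "distance_regular adj"
begin

abbreviation dist_G :: "'n \<Rightarrow> 'n \<Rightarrow> nat" where "dist_G \<equiv> gdist adj"
abbreviation diam :: nat where "diam \<equiv> diameter adj"

section \<open>The path metric of the graph\<close>

lemma adj_sym: "adj x y \<Longrightarrow> adj y x"
  using drg unfolding distance_regular_def simple_graph_def by blast

lemma adj_irrefl: "\<not> adj x x"
  using drg unfolding distance_regular_def simple_graph_def by blast

lemma gdist_walk: "\<exists>p. is_walk adj p (dist_G x y) x y"
proof -
  have "\<exists>n p. is_walk adj p n x y"
    using drg unfolding distance_regular_def connected_graph_def by blast
  then show ?thesis unfolding gdist_def by (rule LeastI_ex)
qed

lemma gdist_le: "is_walk adj p n x y \<Longrightarrow> dist_G x y \<le> n"
  unfolding gdist_def by (rule Least_le) blast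

lemma gdist_refl [simp]: "dist_G x x = 0"
  using gdist_le[of "\<lambda>_. x" 0 x x] by (simp add: is_walk_def)

lemma gdist_eq_0_iff [simp]: "dist_G x y = 0 \<longleftrightarrow> x = y"
  using gdist_walk[of x y] by (auto simp: is_walk_def)

lemma gdist_adj_le: "adj x y \<Longrightarrow> dist_G x y \<le> 1"
  by (rule gdist_le[of "\<lambda>i. if i = 0 then x else y"]) (auto simp: is_walk_def)

lemma gdist_eq_1_iff: "dist_G x y = 1 \<longleftrightarrow> adj x y"
proof
  assume "dist_G x y = 1"
  then show "adj x y" using gdist_walk[of x y] by (auto simp: is_walk_def)
next
  assume a: "adj x y"
  then have "dist_G x y \<noteq> 0" using adj_irrefl by auto
  then show "dist_G x y = 1" using gdist_adj_le[OF a] by linarith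
qed

lemma gdist_commute_le: "dist_G y x \<le> dist_G x y"
proof -
  obtain p where p: "is_walk adj p (dist_G x y) x y" using gdist_walk by blast
  let ?n = "dist_G x y"
  have "is_walk adj (\<lambda>i. p (?n - i)) ?n y x"
    unfolding is_walk_def
  proof (intro conjI allI impI)
    fix i assume i: "i < ?n"
    then have "adj (p (?n - Suc i)) (p (Suc (?n - Suc i)))"
      using p by (auto simp: is_walk_def)
    then show "adj (p (?n - i)) (p (?n - Suc i))"
      using i by (simp add: Suc_diff_Suc adj_sym)
  qed (use p in \<open>auto simp: is_walk_def\<close>)
  then show ?thesis by (rule gdist_le)
qed

lemma gdist_commute: "dist_G x y = dist_G y x"
  using gdist_commute_le[of x y] gdist_commute_le[of y x] by simp

lemma gdist_triangle: "dist_G x z \<le> dist_G x y + dist_G y z"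
proof -
  obtain p where p: "is_walk adj p (dist_G x y) x y" using gdist_walk by blast
  obtain q where q: "is_walk adj q (dist_G y z) y z" using gdist_walk by blast
  let ?n = "dist_G x y"
  have "is_walk adj (\<lambda>i. if i \<le> ?n then p i else q (i - ?n)) (?n + dist_G y z) x z"
    unfolding is_walk_def
  proof (intro conjI allI impI)
    fix i assume i: "i < ?n + dist_G y z"
    show "adj (if i \<le> ?n then p i else q (i - ?n)) (if Suc i \<le> ?n then p (Suc i) else q (Suc i - ?n))"
    proof (cases "i < ?n")
      case True
      then show ?thesis using p by (auto simp: is_walk_def)
    next
      case False
      then have "adj (q (i - ?n)) (q (Suc (i - ?n)))" using q i by (auto simp: is_walk_def)
      moreover have "i = ?n \<Longrightarrow> p i = q 0" using p q by (auto simp: is_walk_def)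
      ultimately show ?thesis using False by (auto simp: Suc_diff_le)
    qed
  qed (use p q in \<open>auto simp: is_walk_def\<close>)
  then show ?thesis by (rule gdist_le)
qed

lemma gdist_adj_bounds:
  assumes "adj x z"
  shows "dist_G x y \<le> dist_G z y + 1" "dist_G z y \<le> dist_G x y + 1"
  using gdist_triangle[of x y z] gdist_triangle[of z y x] gdist_adj_le[OF assms]
    gdist_adj_le[OF adj_sym[OF assms]] by linarith+

lemma geodesic_point:
  assumes "i \<le> dist_G x y"
  shows "\<exists>z. dist_G x z = i \<and> dist_G z y = dist_G x y - i"
proof -
  obtain p where p: "is_walk adj p (dist_G x y) x y" using gdist_walk by blast
  have 1: "dist_G x (p i) \<le> i"
    by (rule gdist_le[of p]) (use p assms in \<open>auto simp: is_walk_def\<close>)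
  have 2: "dist_G (p i) y \<le> dist_G x y - i"
    by (rule gdist_le[of "\<lambda>j. p (i + j)"]) (use p assms in \<open>auto simp: is_walk_def\<close>)
  show ?thesis using 1 2 gdist_triangle[of x y "p i"] assms by (intro exI[of _ "p i"]) linarith
qed

lemma gdist_le_diam: "dist_G x y \<le> diam"
proof -
  have "finite {dist_G x y | x y. True}"
    by (rule finite_subset[of _ "(\<lambda>(x, y). dist_G x y) ` UNIV"]) auto
  then show ?thesis unfolding diameter_def by (intro Max_ge) auto
qed

lemma card_dist_cong:
  assumes "dist_G x y = dist_G x' y'"
  shows "card {z. dist_G x z = i \<and> dist_G z y = j} = card {z. dist_G x' z = i \<and> dist_G z y' = j}"
proof -
  have "{z. dist_G x z = i \<and> dist_G z y = j} = {z. dist_G x z = i \<and> dist_G y z = j}" for x y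
    by (rule Collect_cong) (metis gdist_commute)
  moreover have "card {z. dist_G x z = i \<and> dist_G y z = j} = card {z. dist_G x' z = i \<and> dist_G y' z = j}"
    using drg assms unfolding distance_regular_def by blast
  ultimately show ?thesis by (simp only:)
qed

text \<open>A geodesic between two vertices at distance \<open>diam\<close> passes through every
  smaller distance. Distance-regularity for the pairs (\<open>x\<close>, \<open>x\<close>) and
  (\<open>u\<close>, \<open>u\<close>) carries a point at distance \<open>i\<close> from
  \<open>u\<close> over to \<open>x\<close>.\<close>

lemma ex_dist: "i \<le> diam \<Longrightarrow> \<exists>y. dist_G x y = i"
proof -
  assume i: "i \<le> diam"
  have "finite {dist_G x y | x y. True}" "{dist_G x y | x y. True} \<noteq> {}"
    by (rule finite_subset[of _ "(\<lambda>(x, y). dist_G x y) ` UNIV"]) auto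
  then have "diam \<in> {dist_G x y | x y. True}" unfolding diameter_def by (rule Max_in)
  then obtain u v where "dist_G u v = diam" by auto
  then obtain w where w: "dist_G u w = i" using geodesic_point[of i u v] i by auto
  have "card {z. dist_G x z = i \<and> dist_G z x = i} = card {z. dist_G u z = i \<and> dist_G z u = i}"
    by (rule card_dist_cong) simp
  moreover have "w \<in> {z. dist_G u z = i \<and> dist_G z u = i}" using w by (simp add: gdist_commute)
  then have "card {z. dist_G u z = i \<and> dist_G z u = i} \<noteq> 0" by (metis card_0_eq empty_iff finite)
  ultimately have "{z. dist_G x z = i \<and> dist_G z x = i} \<noteq> {}" by (metis card.empty)
  then show ?thesis by blast
qed

section \<open>Intersection numbers\<close>

definition pair :: "nat \<Rightarrow> 'n \<times> 'n" where
  "pair h = (SOME p. dist_G (fst p) (snd p) = h)"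

lemma pair: "h \<le> diam \<Longrightarrow> dist_G (fst (pair h)) (snd (pair h)) = h"
proof -
  assume "h \<le> diam"
  then obtain y where "dist_G undefined y = h" using ex_dist by blast
  then have "dist_G (fst (undefined, y)) (snd (undefined, y)) = h" by simp
  then show ?thesis unfolding pair_def by (rule someI)
qed

text \<open>For \<open>h \<le> diam\<close> these are the intersection numbers:
  \<open>c\<^sub>h\<close>, \<open>a\<^sub>h\<close>, \<open>b\<^sub>h\<close> for \<open>l\<close>
  equal to \<open>h - 1\<close>, \<open>h\<close>, \<open>h + 1\<close>.\<close>

definition nbrs :: "nat \<Rightarrow> nat \<Rightarrow> nat" where
  "nbrs h l = card {z. adj (fst (pair h)) z \<and> dist_G z (snd (pair h)) = l}"

lemma nbrs: "dist_G x y = h \<Longrightarrow> card {z. adj x z \<and> dist_G z y = l} = nbrs h l"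
  unfolding nbrs_def
  using card_dist_cong[of x y "fst (pair h)" "snd (pair h)" 1 l] pair[of h] gdist_le_diam[of x y]
  by (simp only: gdist_eq_1_iff)

lemma nbrs_pos:
  assumes "dist_G x y = h" "adj x z" "dist_G z y = l"
  shows "nbrs h l > 0"
proof -
  have "z \<in> {z. adj x z \<and> dist_G z y = l}" using assms by simp
  then show ?thesis using nbrs[OF assms(1), of l] by (metis card_gt_0_iff empty_iff finite)
qed

lemma nbrs_Suc_pos: "h < diam \<Longrightarrow> nbrs h (Suc h) > 0"
proof -
  assume h: "h < diam"
  obtain x y where xy: "dist_G x y = Suc h" using ex_dist[of "Suc h"] h by (metis Suc_leI)
  obtain z where z: "dist_G x z = 1" "dist_G z y = h" using geodesic_point[of 1 x y] xy by auto
  show ?thesis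
    by (rule nbrs_pos[of z y h x]) (use z xy in \<open>auto simp: gdist_eq_1_iff[unfolded One_nat_def] intro: adj_sym\<close>)
qed

lemma nbrs_pred_pos: "Suc h \<le> diam \<Longrightarrow> nbrs (Suc h) h > 0"
proof -
  assume h: "Suc h \<le> diam"
  obtain x y where xy: "dist_G x y = Suc h" using ex_dist[OF h] by blast
  obtain z where z: "dist_G x z = 1" "dist_G z y = h" using geodesic_point[of 1 x y] xy by auto
  show ?thesis
    by (rule nbrs_pos[of x y "Suc h" z]) (use z xy in \<open>auto simp: gdist_eq_1_iff[unfolded One_nat_def] intro: adj_sym\<close>)
qed

lemma nbrs_eq_0:
  assumes "h \<le> diam" "l + 1 < h \<or> h + 1 < l"
  shows "nbrs h l = 0"
proof -
  obtain x y where xy: "dist_G x y = h" using ex_dist[OF assms(1)] by blast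
  have "{z. adj x z \<and> dist_G z y = l} = {}"
    using assms(2) xy gdist_adj_bounds[of x _ y] by fastforce
  then show ?thesis using nbrs[OF xy, of l] by (metis card.empty)
qed

definition A :: "'n \<Rightarrow> 'n \<Rightarrow> real" where "A x y = of_bool (adj x y)"

lemma A_commute: "A x y = A y x"
  unfolding A_def using adj_sym by auto

text \<open>Neighbours of \<open>x\<close> are grouped by their distance to \<open>y\<close>: on
  functions of that distance the adjacency matrix acts as the intersection matrix.\<close>

lemma sum_nbrs:
  fixes f :: "nat \<Rightarrow> real"
  assumes "dist_G x y = h"
  shows "(\<Sum>z\<in>UNIV. A x z * f (dist_G z y)) = (\<Sum>l\<le>diam. real (nbrs h l) * f l)"
proof -
  have "(\<Sum>z\<in>UNIV. A x z * f (dist_G z y)) = (\<Sum>z\<in>{z. adj x z}. f (dist_G z y))"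
    by (rule sum.mono_neutral_cong_right) (auto simp: A_def)
  also have "\<dots> = (\<Sum>l\<le>diam. \<Sum>z\<in>{z\<in>{z. adj x z}. dist_G z y = l}. f (dist_G z y))"
    by (rule sum.group[symmetric]) (auto simp: gdist_le_diam)
  also have "\<dots> = (\<Sum>l\<le>diam. real (nbrs h l) * f l)"
    by (rule sum.cong) (simp_all add: nbrs[OF assms, symmetric])
  finally show ?thesis .
qed

end

section \<open>Primitive idempotents and Krein parameters\<close>

lemma sum_swap3:
  "(\<Sum>a\<in>A. \<Sum>z\<in>B. \<Sum>z'\<in>C. F a z z') = (\<Sum>z\<in>B. \<Sum>z'\<in>C. \<Sum>a\<in>A. F a z z')"
  by (subst sum.swap, rule sum.cong[OF refl], rule sum.swap)

locale idempotents = drg adj for adj :: "'n::finite \<Rightarrow> 'n \<Rightarrow> bool" +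
  fixes E :: "nat \<Rightarrow> real^'n^'n"
  assumes ord: "idempotent_ordering adj E"
begin

section \<open>The basis of primitive idempotents\<close>

definition e :: "nat \<Rightarrow> 'n \<Rightarrow> 'n \<Rightarrow> real" where "e i x y = E i $ x $ y"

text \<open>For \<open>i \<le> diam\<close> this is the common entry of \<open>E i\<close> at
  distance \<open>h\<close>. So \<open>u i h / u i 0\<close> is the cosine sequence of
  \<open>E i\<close>, and \<open>u 1 h\<close> is the dual eigenvalue at \<open>h\<close> divided by
  the number of vertices.\<close>

definition u :: "nat \<Rightarrow> nat \<Rightarrow> real" where "u i h = e i (fst (pair h)) (snd (pair h))"

lemma bose_mesner_entry:
  assumes "B \<in> bose_mesner adj"
  obtains f where "\<And>x y. B $ x $ y = f (dist_G x y)"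
proof -
  obtain c where c: "B = (\<Sum>i\<le>diam. c i *\<^sub>R dist_mat adj i)"
    using assms unfolding bose_mesner_def by blast
  have "B $ x $ y = c (dist_G x y)" for x y
    unfolding c dist_mat_def
    by (simp add: if_distrib[of "\<lambda>t. c _ * t"] gdist_le_diam cong: if_cong)
  then show ?thesis by (rule that)
qed

lemma bose_mesner_I: "(\<chi> x y. f (dist_G x y)) \<in> bose_mesner adj"
proof -
  have "(\<chi> x y. f (dist_G x y)) = (\<Sum>i\<le>diam. f i *\<^sub>R dist_mat adj i)"
    unfolding dist_mat_def
    by (simp add: vec_eq_iff if_distrib[of "\<lambda>t. f _ * t"] gdist_le_diam cong: if_cong)
  then show ?thesis unfolding bose_mesner_def by blast
qed

lemma E_bm: "i \<le> diam \<Longrightarrow> E i \<in> bose_mesner adj" and E_neq_0: "i \<le> diam \<Longrightarrow> E i \<noteq> 0"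
  and E_mult: "i \<le> diam \<Longrightarrow> j \<le> diam \<Longrightarrow> E i ** E j = (if i = j then E i else 0)"
  and E_sum: "(\<Sum>i\<le>diam. E i) = mat 1"
  and E_0: "E 0 = (1 / real CARD('n)) *\<^sub>R all_ones"
  and E_beyond: "i > diam \<Longrightarrow> E i = 0"
  using ord unfolding idempotent_ordering_def by blast+

lemma e_u: "i \<le> diam \<Longrightarrow> e i x y = u i (dist_G x y)"
proof -
  assume "i \<le> diam"
  then obtain f where "\<And>x y. E i $ x $ y = f (dist_G x y)" using bose_mesner_entry E_bm by blast
  then show ?thesis unfolding u_def e_def using pair[OF gdist_le_diam] by metis
qed

lemma e_commute: "i \<le> diam \<Longrightarrow> e i x y = e i y x"
  using e_u gdist_commute by metis

lemma e_mult:
  "i \<le> diam \<Longrightarrow> j \<le> diam \<Longrightarrow> (\<Sum>z\<in>UNIV. e i x z * e j z y) = (if i = j then e i x y else 0)"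
  using arg_cong[OF E_mult[of i j], of "\<lambda>B. B $ x $ y"]
  unfolding e_def matrix_matrix_mult_def by (simp split: if_splits)

lemma e_sum: "(\<Sum>i\<le>diam. e i x y) = (if x = y then 1 else 0)"
  using arg_cong[OF E_sum, of "\<lambda>B. B $ x $ y"] unfolding e_def mat_def by simp

lemma e_0: "e 0 x y = 1 / real CARD('n)"
  unfolding e_def E_0 all_ones_def by simp

text \<open>The squared Frobenius norm of \<open>E h\<close>, which normalises coefficients with
  respect to the idempotents.\<close>

definition M :: "nat \<Rightarrow> real" where "M h = (\<Sum>x\<in>UNIV. \<Sum>y\<in>UNIV. e h x y * e h x y)"

lemma M_pos: assumes "i \<le> diam" shows "M i > 0"
proof -
  obtain a b where ab: "e i a b \<noteq> 0"
    using E_neq_0[OF assms] unfolding e_def vec_eq_iff by auto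
  have "0 < e i a b * e i a b" using ab by (simp add: zero_less_mult_iff) linarith
  also have "\<dots> \<le> (\<Sum>y\<in>UNIV. e i a y * e i a y)"
    by (rule member_le_sum) auto
  also have "\<dots> \<le> M i"
    unfolding M_def by (rule member_le_sum[of a UNIV "\<lambda>x. \<Sum>y\<in>UNIV. e i x y * e i x y"]) (auto intro: sum_nonneg)
  finally show ?thesis .
qed

lemma e_diag: "i \<le> diam \<Longrightarrow> (\<Sum>z\<in>UNIV. e i x z * e i x z) = u i 0"
  using e_mult[of i i x x] e_u[of i x x] e_commute[of i] by simp

lemma u_0_pos: assumes "i \<le> diam" shows "u i 0 > 0"
proof -
  have "M i = (\<Sum>x\<in>(UNIV::'n set). u i 0)" unfolding M_def using e_diag[OF assms] by simp
  then show ?thesis using M_pos[OF assms] by (simp add: zero_less_mult_iff)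
qed

lemma E_orthogonal:
  assumes "i \<le> diam" "j \<le> diam" "i \<noteq> j"
  shows "(\<Sum>x\<in>UNIV. \<Sum>y\<in>UNIV. e i x y * e j x y) = 0"
proof -
  have "(\<Sum>y\<in>UNIV. e i x y * e j x y) = 0" for x
    using e_mult[OF assms(1,2), of x x] assms e_commute[of j x] by simp
  then show ?thesis by simp
qed

text \<open>Dimension count: the \<open>diam + 1\<close> idempotents are orthogonal and nonzero,
  hence independent, and they lie in the span of \<open>diam + 1\<close> distance matrices. So they
  span every matrix whose entries depend only on the distance.\<close>

lemma idempotents_span:
  obtains c where "\<And>x y. f (dist_G x y) = (\<Sum>i\<le>diam. c i * e i x y)"
proof -
  let ?B = "E ` {..diam}"
  have inner: "E i \<bullet> E j = (\<Sum>x\<in>UNIV. \<Sum>y\<in>UNIV. e i x y * e j x y)" for i j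
    unfolding inner_vec_def e_def by simp
  have inj: "inj_on E {..diam}"
  proof (rule inj_onI)
    fix i j assume ij: "i \<in> {..diam}" "j \<in> {..diam}" "E i = E j"
    show "i = j"
    proof (rule ccontr)
      assume "i \<noteq> j"
      then have "E i ** E i = 0" using E_mult[of i j] ij by simp
      then show False using E_mult[of i i] E_neq_0[of i] ij by simp
    qed
  qed
  have "pairwise orthogonal ?B"
    unfolding pairwise_def orthogonal_def using E_orthogonal inner by auto
  then have ind: "independent ?B"
    by (rule pairwise_orthogonal_independent) (use E_neq_0 in auto)
  have in_span: "(\<Sum>i\<le>diam. c i *\<^sub>R dist_mat adj i) \<in> span (dist_mat adj ` {..diam})" for c
    by (rule span_sum, rule span_scale, rule span_base) simp
  have sub: "?B \<subseteq> span (dist_mat adj ` {..diam})"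
  proof
    fix X assume "X \<in> ?B"
    then obtain c where "X = (\<Sum>i\<le>diam. c i *\<^sub>R dist_mat adj i)"
      using E_bm unfolding bose_mesner_def by auto
    then show "X \<in> span (dist_mat adj ` {..diam})"
      using in_span by simp
  qed
  have "dim (span (dist_mat adj ` {..diam})) \<le> card (dist_mat adj ` {..diam})"
    by (simp add: dim_le_card')
  also have "\<dots> \<le> card ?B" using card_image[OF inj] card_image_le[of "{..diam}" "dist_mat adj"] by simp
  finally have le: "dim (span (dist_mat adj ` {..diam})) \<le> card ?B" .
  have spn: "span (dist_mat adj ` {..diam}) \<subseteq> span ?B"
    by (rule card_ge_dim_independent[OF sub ind le])
  have "(\<chi> x y. f (dist_G x y)) \<in> span (dist_mat adj ` {..diam})"
    using bose_mesner_I[of f] in_span unfolding bose_mesner_def by fastforce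
  then have "(\<chi> x y. f (dist_G x y)) \<in> span ?B" using spn by blast
  then have "\<exists>c. (\<chi> x y. f (dist_G x y)) = (\<Sum>i\<le>diam. c i *\<^sub>R E i)"
  proof (induction rule: span_induct_alt)
    case base
    show ?case by (rule exI[of _ "\<lambda>_. 0"]) simp
  next
    case (step a X Y)
    then obtain j c where j: "X = E j" "j \<le> diam" and c: "Y = (\<Sum>i\<le>diam. c i *\<^sub>R E i)" by auto
    have "(\<Sum>i\<le>diam. (if i = j then a else 0) *\<^sub>R E i) = a *\<^sub>R E j"
      using j(2) by (simp add: if_distrib[of "\<lambda>t. t *\<^sub>R _"] cong: if_cong)
    then show ?case
      by (intro exI[of _ "\<lambda>i. (if i = j then a else 0) + c i"])
        (simp add: j c scaleR_add_left sum.distrib)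
  qed
  then obtain c where c: "(\<chi> x y. f (dist_G x y)) = (\<Sum>i\<le>diam. c i *\<^sub>R E i)" by blast
  have "f (dist_G x y) = (\<Sum>i\<le>diam. c i * e i x y)" for x y
    using arg_cong[OF c, of "\<lambda>B. B $ x $ y"] unfolding e_def by simp
  then show ?thesis by (rule that)
qed

text \<open>Distinct idempotents are orthogonal for the entrywise inner product, so pairing with
  \<open>E h\<close> isolates one coefficient.\<close>

lemma sum_e_mult:
  assumes "h \<le> diam"
  shows "(\<Sum>x\<in>UNIV. \<Sum>y\<in>UNIV. (\<Sum>i\<le>diam. c i * e i x y) * e h x y) = c h * M h"
proof -
  have "(\<Sum>x\<in>UNIV. \<Sum>y\<in>UNIV. (\<Sum>i\<le>diam. c i * e i x y) * e h x y)
      = (\<Sum>x\<in>UNIV. \<Sum>y\<in>UNIV. \<Sum>i\<le>diam. c i * (e i x y * e h x y))"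
    by (simp add: sum_distrib_right mult.assoc)
  also have "\<dots> = (\<Sum>x\<in>UNIV. \<Sum>i\<le>diam. \<Sum>y\<in>UNIV. c i * (e i x y * e h x y))"
    by (subst sum.swap) simp
  also have "\<dots> = (\<Sum>i\<le>diam. \<Sum>x\<in>UNIV. \<Sum>y\<in>UNIV. c i * (e i x y * e h x y))"
    by (rule sum.swap)
  also have "\<dots> = (\<Sum>i\<le>diam. c i * (\<Sum>x\<in>UNIV. \<Sum>y\<in>UNIV. e i x y * e h x y))"
    by (simp add: sum_distrib_left)
  also have "\<dots> = (\<Sum>i\<le>diam. if i = h then c h * M h else 0)"
    by (rule sum.cong) (auto simp: M_def E_orthogonal[OF _ assms])
  also have "\<dots> = c h * M h" using assms by simp
  finally show ?thesis .
qed

text \<open>A Krein parameter up to a positive factor, \<open>q^h_ij * M h / |X|\<close>. In this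
  form it is symmetric in all three indices.\<close>

definition T :: "nat \<Rightarrow> nat \<Rightarrow> nat \<Rightarrow> real" where
  "T i j h = (\<Sum>x\<in>UNIV. \<Sum>y\<in>UNIV. e i x y * e j x y * e h x y)"

lemma T_swap12: "T i j h = T j i h" and T_swap23: "T i j h = T i h j"
  unfolding T_def by (simp_all add: mult_ac)

text \<open>The Krein parameter divided by the number of vertices, that is, the coefficient of
  \<open>E h\<close> in the Schur product of \<open>E i\<close> and \<open>E j\<close>.\<close>

definition \<kappa> :: "nat \<Rightarrow> nat \<Rightarrow> nat \<Rightarrow> real" where "\<kappa> i j h = T i j h / M h"

lemma \<kappa>_eq_0_iff: "h \<le> diam \<Longrightarrow> \<kappa> i j h = 0 \<longleftrightarrow> T i j h = 0"
  unfolding \<kappa>_def using M_pos[of h] by simp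

lemma schur:
  assumes "i \<le> diam" "j \<le> diam"
  shows "e i x y * e j x y = (\<Sum>h\<le>diam. \<kappa> i j h * e h x y)"
proof -
  obtain c where c: "\<And>x y. u i (dist_G x y) * u j (dist_G x y) = (\<Sum>h\<le>diam. c h * e h x y)"
    using idempotents_span[of "\<lambda>t. u i t * u j t"] by blast
  have "\<kappa> i j h = c h" if h: "h \<le> diam" for h
  proof -
    have "T i j h = c h * M h"
      unfolding T_def e_u[OF assms(1)] e_u[OF assms(2)] c by (rule sum_e_mult[OF h])
    then show ?thesis unfolding \<kappa>_def using M_pos[OF h] by simp
  qed
  then show ?thesis using c assms by (simp add: e_u[symmetric])
qed

lemma schur_project:
  assumes "i \<le> diam" "j \<le> diam" "h \<le> diam"
  shows "(\<Sum>z\<in>UNIV. e h a z * (e i z b * e j z b)) = \<kappa> i j h * e h a b"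
proof -
  have "(\<Sum>z\<in>UNIV. e h a z * (e i z b * e j z b)) = (\<Sum>z\<in>UNIV. \<Sum>l\<le>diam. \<kappa> i j l * (e h a z * e l z b))"
    using assms by (simp add: schur sum_distrib_left mult_ac)
  also have "\<dots> = (\<Sum>l\<le>diam. \<kappa> i j l * (\<Sum>z\<in>UNIV. e h a z * e l z b))"
    by (subst sum.swap) (simp add: sum_distrib_left)
  also have "\<dots> = (\<Sum>l\<le>diam. if l = h then \<kappa> i j h * e h a b else 0)"
    by (rule sum.cong) (use assms in \<open>auto simp: e_mult\<close>)
  also have "\<dots> = \<kappa> i j h * e h a b" using assms by simp
  finally show ?thesis .
qed

text \<open>Orthogonality makes the coefficients up to \<open>diam\<close> unique, and the condition
  that \<open>q\<close> vanishes beyond \<open>diam\<close> makes \<open>q\<close> unique as a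
  function, so the definite description is proper.\<close>

lemma krein_eq:
  assumes "i \<le> diam" "j \<le> diam" "h \<le> diam"
  shows "krein adj E i j h = real CARD('n) * \<kappa> i j h"
proof -
  let ?n = "real CARD('n)"
  let ?P = "\<lambda>q. (\<forall>l>diam. q l = 0) \<and>
      hadamard (E i) (E j) = (1 / ?n) *\<^sub>R (\<Sum>l\<le>diam. q l *\<^sub>R E l)"
  let ?q = "\<lambda>l. if l \<le> diam then ?n * \<kappa> i j l else 0"
  have n: "?n \<noteq> 0" by simp
  have entry: "hadamard (E i) (E j) = (1 / ?n) *\<^sub>R (\<Sum>l\<le>diam. q l *\<^sub>R E l) \<longleftrightarrow>
      (\<forall>x y. e i x y * e j x y = (\<Sum>l\<le>diam. q l / ?n * e l x y))" for q
    unfolding hadamard_def vec_eq_iff e_def by (simp add: sum_divide_distrib)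
  have "?P ?q"
    unfolding entry using schur[OF assms(1,2)] by simp
  moreover have "q = ?q" if q: "?P q" for q
  proof
    fix l show "q l = ?q l"
    proof (cases "l \<le> diam")
      case True
      have "T i j l = (q l / ?n) * M l"
        unfolding T_def using sum_e_mult[OF True, of "\<lambda>l. q l / ?n"] q unfolding entry by simp
      then have "\<kappa> i j l = q l / ?n" unfolding \<kappa>_def using M_pos[OF True] by simp
      then show ?thesis using True by simp
    qed (use q in auto)
  qed
  ultimately have "(THE q. ?P q) = ?q" by (rule the_equality)
  then show ?thesis unfolding krein_def using assms(3) by simp
qed

lemma krein_eq_0_iff:
  assumes "i \<le> diam" "j \<le> diam" "h \<le> diam"
  shows "krein adj E i j h = 0 \<longleftrightarrow> T i j h = 0"
  using krein_eq[OF assms] \<kappa>_eq_0_iff[OF assms(3)] by simp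

text \<open>The triple sums squared and summed over all three points collapse to the entrywise
  triple product, because each idempotent is its own Gram matrix.\<close>

lemma krein_triple_zero:
  assumes "i \<le> diam" "j \<le> diam" "h \<le> diam" "T i j h = 0"
  shows "(\<Sum>z\<in>UNIV. e i z a * e j z b * e h z c) = 0"
proof -
  let ?S = "\<lambda>a b c. \<Sum>z\<in>UNIV. e i z a * e j z b * e h z c"
  let ?g = "\<lambda>l z z'. \<Sum>a\<in>UNIV. e l z a * e l z' a"
  have gram: "?g l z z' = e l z z'" if "l \<le> diam" for l z z'
    using e_mult[OF that that, of z z'] e_commute[OF that] by simp
  have pull: "(\<Sum>b\<in>UNIV. r * (f b * s)) = r * ((\<Sum>b\<in>UNIV. f b) * s)" for r s and f :: "'n \<Rightarrow> real"
    by (simp add: sum_distrib_left sum_distrib_right)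
  have "(\<Sum>a\<in>UNIV. \<Sum>b\<in>UNIV. \<Sum>c\<in>UNIV. ?S a b c * ?S a b c)
      = (\<Sum>a\<in>UNIV. \<Sum>b\<in>UNIV. \<Sum>c\<in>UNIV. \<Sum>z\<in>UNIV. \<Sum>z'\<in>UNIV.
          (e i z a * e i z' a) * ((e j z b * e j z' b) * (e h z c * e h z' c)))"
    by (simp add: sum_product mult_ac)
  also have "\<dots> = (\<Sum>a\<in>UNIV. \<Sum>b\<in>UNIV. \<Sum>z\<in>UNIV. \<Sum>z'\<in>UNIV.
          (e i z a * e i z' a) * ((e j z b * e j z' b) * ?g h z z'))"
    by (rule sum.cong[OF refl], rule sum.cong[OF refl], subst sum_swap3) (simp add: sum_distrib_left)
  also have "\<dots> = (\<Sum>a\<in>UNIV. \<Sum>z\<in>UNIV. \<Sum>z'\<in>UNIV.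
          (e i z a * e i z' a) * (?g j z z' * ?g h z z'))"
    by (rule sum.cong[OF refl], subst sum_swap3) (simp only: pull)
  also have "\<dots> = (\<Sum>z\<in>UNIV. \<Sum>z'\<in>UNIV. ?g i z z' * (?g j z z' * ?g h z z'))"
    by (subst sum_swap3) (simp only: sum_distrib_right)
  also have "\<dots> = 0" using assms by (simp add: gram T_def mult.assoc)
  finally have 0: "(\<Sum>a\<in>UNIV. \<Sum>b\<in>UNIV. \<Sum>c\<in>UNIV. ?S a b c * ?S a b c) = 0" .
  have "?S a b c * ?S a b c \<le> (\<Sum>c\<in>UNIV. ?S a b c * ?S a b c)"
    by (rule member_le_sum) auto
  also have "\<dots> \<le> (\<Sum>b\<in>UNIV. \<Sum>c\<in>UNIV. ?S a b c * ?S a b c)"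
    by (rule member_le_sum[of b UNIV "\<lambda>b. \<Sum>c\<in>UNIV. ?S a b c * ?S a b c"]) (auto intro: sum_nonneg)
  also have "\<dots> \<le> (\<Sum>a\<in>UNIV. \<Sum>b\<in>UNIV. \<Sum>c\<in>UNIV. ?S a b c * ?S a b c)"
    by (rule member_le_sum[of a UNIV "\<lambda>a. \<Sum>b\<in>UNIV. \<Sum>c\<in>UNIV. ?S a b c * ?S a b c"])
      (auto intro!: sum_nonneg)
  also note 0
  finally have "?S a b c * ?S a b c \<le> 0" .
  then show ?thesis using mult_le_0_iff[of "?S a b c" "?S a b c"] by linarith
qed

text \<open>The coefficient of \<open>A\<close> at \<open>E i\<close>, read off by the inner
  product; it is the eigenvalue of \<open>A\<close> on the columns of \<open>E i\<close>.\<close>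

definition \<theta> :: "nat \<Rightarrow> real" where
  "\<theta> i = (\<Sum>x\<in>UNIV. \<Sum>z\<in>UNIV. A x z * e i x z) / M i"

lemma A_decomp: "A x y = (\<Sum>i\<le>diam. \<theta> i * e i x y)"
proof -
  obtain c where c: "\<And>x y. of_bool (dist_G x y = 1) = (\<Sum>i\<le>diam. c i * e i x y)"
    using idempotents_span[of "\<lambda>t. of_bool (t = 1)"] by blast
  have A: "A x y = (\<Sum>i\<le>diam. c i * e i x y)" for x y
    using c[of x y] unfolding A_def gdist_eq_1_iff .
  have "\<theta> h = c h" if h: "h \<le> diam" for h
    using sum_e_mult[OF h, of c] M_pos[OF h] unfolding \<theta>_def A by simp
  then show ?thesis using A by simp
qed

lemma A_eigen:
  assumes "i \<le> diam"
  shows "(\<Sum>z\<in>UNIV. A x z * e i z y) = \<theta> i * e i x y"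
proof -
  have "(\<Sum>z\<in>UNIV. A x z * e i z y) = (\<Sum>z\<in>UNIV. \<Sum>l\<le>diam. \<theta> l * (e l x z * e i z y))"
    by (simp add: A_decomp sum_distrib_right mult.assoc)
  also have "\<dots> = (\<Sum>l\<le>diam. \<theta> l * (\<Sum>z\<in>UNIV. e l x z * e i z y))"
    by (subst sum.swap) (simp add: sum_distrib_left)
  also have "\<dots> = (\<Sum>l\<le>diam. if l = i then \<theta> i * e i x y else 0)"
    by (rule sum.cong) (use assms in \<open>auto simp: e_mult\<close>)
  also have "\<dots> = \<theta> i * e i x y" using assms by simp
  finally show ?thesis .
qed

text \<open>A column of \<open>E i\<close> is an eigenvector of \<open>A\<close> that depends only
  on the distance to its base point, so the eigenvector equation descends to the intersection
  matrix.\<close>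

lemma u_recurrence:
  assumes "i \<le> diam" "h \<le> diam"
  shows "(\<Sum>l\<le>diam. real (nbrs h l) * u i l) = \<theta> i * u i h"
proof -
  obtain x y where xy: "dist_G x y = h" using ex_dist[OF assms(2)] by blast
  have "(\<Sum>l\<le>diam. real (nbrs h l) * u i l) = (\<Sum>z\<in>UNIV. A x z * u i (dist_G z y))"
    by (rule sum_nbrs[OF xy, symmetric])
  also have "\<dots> = (\<Sum>z\<in>UNIV. A x z * e i z y)" using assms(1) by (simp add: e_u)
  also have "\<dots> = \<theta> i * u i h" using A_eigen[OF assms(1)] e_u[OF assms(1)] xy by simp
  finally show ?thesis .
qed

end

section \<open>Vanishing of the first dual intersection number\<close>

lemma matrix_mult_sum_right: "(X::real^'n^'n) ** (\<Sum>i\<in>I. f i) = (\<Sum>i\<in>I. X ** f i)"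
  by (induction I rule: infinite_finite_induct) (simp_all add: matrix_add_ldistrib)

lemma matrix_mult_sum_left: "(\<Sum>i\<in>I. f i) ** (X::real^'n^'n) = (\<Sum>i\<in>I. f i ** X)"
  unfolding vec_eq_iff matrix_matrix_mult_def
  by (auto simp: sum_distrib_right intro: sum.swap)

section \<open>Dual adjacency matrices\<close>

context idempotents
begin

lemma resolve_identity: "(X :: real^'n^'n) ** (Y :: real^'n^'n) = (\<Sum>l\<le>diam. X ** E l ** Y)"
proof -
  have "X ** Y = X ** (\<Sum>l\<le>diam. E l) ** Y" by (simp only: E_sum matrix_mul_rid)
  then show ?thesis by (simp only: matrix_mult_sum_right matrix_mult_sum_left)
qed

text \<open>Up to the factor \<open>|X|\<close>, the dual adjacency matrix with base point
  \<open>y\<close>.\<close>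

definition Dg :: "'n \<Rightarrow> real^'n^'n" where
  "Dg y = (\<chi> a b. if a = b then e 1 a y else 0)"

lemma Dg_mult_left: "(Dg y ** X) $ a $ b = e 1 a y * X $ a $ b"
  unfolding Dg_def matrix_matrix_mult_def
  by (simp add: if_distrib[of "\<lambda>t. t * _"] cong: if_cong)

lemma Dg_mult_right: "(X ** Dg y) $ a $ b = X $ a $ b * e 1 b y"
  unfolding Dg_def matrix_matrix_mult_def
  by (simp add: if_distrib[of "\<lambda>t. _ * t"] cong: if_cong)

lemma Dg_commute: "Dg y ** Dg w = Dg w ** Dg y"
  unfolding vec_eq_iff Dg_mult_left by (auto simp: Dg_def)

lemma E_Dg_E_entry: "(E i ** Dg y ** E j) $ a $ b = (\<Sum>z\<in>UNIV. e i a z * e 1 z y * e j z b)"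
  unfolding matrix_matrix_mult_def[of _ "E j"] by (simp add: Dg_mult_right e_def)

lemma E_Dg_E_eq_0:
  assumes "i \<le> diam" "j \<le> diam" "1 \<le> diam" "T i 1 j = 0"
  shows "E i ** Dg y ** E j = 0"
  unfolding vec_eq_iff E_Dg_E_entry
  using krein_triple_zero[OF assms(1,3,2,4)] e_commute[OF assms(1)] by simp

text \<open>Since the base point equals the column index, the triple sum becomes a projection of the
  Schur product of \<open>E 1\<close> and \<open>E j\<close>.\<close>

lemma E_Dg_E_diagonal_entry:
  assumes "i \<le> diam" "j \<le> diam" "1 \<le> diam"
  shows "(E i ** Dg b ** E j) $ a $ b = \<kappa> 1 j i * e i a b"
  unfolding E_Dg_E_entry using schur_project[OF assms(3,2,1), of a b] by (simp add: mult.assoc)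

text \<open>The identity, written as the sum of all \<open>E l\<close>, is put between the two
  diagonal matrices; each \<open>l \<noteq> m\<close> is killed by the factor on its left or on its
  right.\<close>

lemma insert_idempotent:
  assumes "i \<le> diam" "j \<le> diam" "m \<le> diam" "1 \<le> diam"
    and "\<And>l. l \<le> diam \<Longrightarrow> l \<noteq> m \<Longrightarrow> T i 1 l = 0 \<or> T l 1 j = 0"
  shows "E i ** Dg a ** Dg b ** E j = E i ** Dg a ** E m ** Dg b ** E j"
proof -
  have "E i ** Dg a ** Dg b ** E j = (E i ** Dg a) ** (Dg b ** E j)"
    by (simp add: matrix_mul_assoc)
  also have "\<dots> = (\<Sum>l\<le>diam. (E i ** Dg a) ** E l ** (Dg b ** E j))"
    by (rule resolve_identity)
  also have "\<dots> = (\<Sum>l\<le>diam. if l = m then (E i ** Dg a) ** E m ** (Dg b ** E j) else 0)"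
  proof (rule sum.cong)
    fix l assume l: "l \<in> {..diam}"
    have "(E i ** Dg a) ** E l ** (Dg b ** E j) = 0" if ne: "l \<noteq> m"
    proof -
      consider "T i 1 l = 0" | "T l 1 j = 0" using assms(5)[of l] ne l by auto
      then show ?thesis
      proof cases
      case 2
      then have "E l ** Dg b ** E j = 0" using E_Dg_E_eq_0 assms l by simp
      then show ?thesis by (metis matrix_mul_assoc times0_right)
      qed (use E_Dg_E_eq_0[of i l] assms l in auto)
    qed
    then show "(E i ** Dg a) ** E l ** (Dg b ** E j) =
        (if l = m then (E i ** Dg a) ** E m ** (Dg b ** E j) else 0)" by simp
  qed simp
  also have "\<dots> = E i ** Dg a ** E m ** Dg b ** E j"
    using assms(3) by (simp add: matrix_mul_assoc)
  finally show ?thesis .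
qed

text \<open>Diagonal entries are compared: \<open>\<kappa> 1 1 1\<close> is the eigenvalue by which
  \<open>E 1\<close> acts on the \<open>E 1\<close> part of its own Schur square.\<close>

lemma Dg_square_sum:
  assumes "1 \<le> diam"
  shows "\<kappa> 1 1 1 *\<^sub>R Dg y = (\<Sum>w\<in>UNIV. e 1 w y *\<^sub>R (Dg w ** Dg w))"
proof -
  have "(\<Sum>w\<in>UNIV. e 1 w y * (e 1 a w * e 1 a w)) = \<kappa> 1 1 1 * e 1 a y" for a
    using schur_project[OF assms assms assms, of y a] e_commute[OF assms] by simp
  then show ?thesis
    unfolding vec_eq_iff by (simp add: Dg_mult_left) (simp add: Dg_def sum.neutral)
qed

text \<open>The recurrence determines a cosine sequence from its eigenvalue. Equal eigenvalues would
  make two idempotents proportional, against their orthogonality.\<close>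

lemma \<theta>_inj:
  assumes i: "i \<le> diam" and j: "j \<le> diam" and eq: "\<theta> i = \<theta> j"
  shows "i = j"
proof (rule ccontr)
  assume "i \<noteq> j"
  have ratio: "t \<le> diam \<Longrightarrow> u i t * u j 0 = u j t * u i 0" for t
  proof (induction t rule: less_induct)
    case (less t)
    show ?case
    proof (cases t)
      case (Suc s)
      let ?D = "\<lambda>l. u i l * u j 0 - u j l * u i 0"
      have s: "s \<le> diam" "s < diam" using less.prems Suc by auto
      have "(\<Sum>l\<le>diam. real (nbrs s l) * ?D l)
          = (\<Sum>l\<le>diam. real (nbrs s l) * u i l) * u j 0 - (\<Sum>l\<le>diam. real (nbrs s l) * u j l) * u i 0"
        by (simp add: sum_distrib_right right_diff_distrib sum_subtractf mult.assoc)
      also have "\<dots> = \<theta> i * ?D s"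
        by (simp add: u_recurrence i j s eq algebra_simps)
      also have "\<dots> = 0" using less.IH[of s] Suc s by simp
      \<comment> \<open>In row \<open>s = t - 1\<close> the terms with \<open>l < t\<close> vanish
        by induction and those with \<open>l > t\<close> because a neighbour is at most one step
        farther.\<close>
      also have "(\<Sum>l\<le>diam. real (nbrs s l) * ?D l)
          = (\<Sum>l\<le>diam. if l = t then real (nbrs s t) * ?D t else 0)"
      proof (rule sum.cong)
        fix l assume "l \<in> {..diam}"
        moreover have "l < t \<or> l = t \<or> s + 1 < l" using Suc by linarith
        ultimately show "real (nbrs s l) * ?D l = (if l = t then real (nbrs s t) * ?D t else 0)"
          using less.IH[of l] nbrs_eq_0[of s l] s by auto
      qed simp
      finally have "real (nbrs s t) * ?D t = 0" using less.prems by simp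
      then show ?thesis using nbrs_Suc_pos[OF s(2)] Suc by simp
    qed simp
  qed
  fix x :: 'n
  have "(\<Sum>z\<in>UNIV. e i x z * e i x z) * u j 0 = (\<Sum>z\<in>UNIV. e i x z * (u i (dist_G x z) * u j 0))"
    by (simp add: sum_distrib_right mult.assoc e_u i)
  also have "\<dots> = (\<Sum>z\<in>UNIV. e i x z * e j z x) * u i 0"
    using e_u[OF j] e_commute[OF j] by (simp add: ratio gdist_le_diam sum_distrib_right mult.assoc)
  also have "\<dots> = 0" using \<open>i \<noteq> j\<close> i j by (simp add: e_mult)
  finally show False using u_0_pos[OF i] u_0_pos[OF j] by (simp add: e_diag[OF i])
qed

lemma schur_u:
  assumes "i \<le> diam" "j \<le> diam" "t \<le> diam"
  shows "u i t * u j t = (\<Sum>h\<le>diam. \<kappa> i j h * u h t)"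
proof -
  obtain x y where "dist_G x y = t" using ex_dist[OF assms(3)] by blast
  then show ?thesis using schur[OF assms(1,2), of x y] assms by (simp add: e_u)
qed

lemma u_0: "u 0 t = 1 / real CARD('n)"
  unfolding u_def by (rule e_0)

end

text \<open>The Q-polynomial condition in terms of \<open>T\<close>; the cases where
  \<open>i\<close> or \<open>j\<close> is the large index follow by the symmetry of
  \<open>T\<close>.\<close>

locale q_poly = idempotents adj E
  for adj :: "'n::finite \<Rightarrow> 'n \<Rightarrow> bool" and E +
  assumes diam_pos: "diam \<ge> 1"
    and T_far: "i \<le> diam \<Longrightarrow> j \<le> diam \<Longrightarrow> h \<le> diam \<Longrightarrow> i + j < h \<Longrightarrow> T i j h = 0"
    and T_sum: "i + j \<le> diam \<Longrightarrow> T i j (i + j) \<noteq> 0"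
begin

lemma T_far1: "i \<le> diam \<Longrightarrow> j \<le> diam \<Longrightarrow> i + 1 < j \<or> j + 1 < i \<Longrightarrow> T i 1 j = 0 \<and> T 1 i j = 0"
  using T_far[of i 1 j] T_far[of j 1 i] diam_pos T_swap12 T_swap23 by metis

lemma T_next: "Suc i \<le> diam \<Longrightarrow> T i 1 (Suc i) \<noteq> 0 \<and> T 1 i (Suc i) \<noteq> 0 \<and> T (Suc i) 1 i \<noteq> 0 \<and> T 1 (Suc i) i \<noteq> 0"
  using T_sum[of i 1] T_swap12 T_swap23 by (metis Suc_eq_plus1)

text \<open>Dual to \<open>\<theta>_inj\<close>: multiplication by \<open>E 1\<close> is a
  three-term recurrence in the index \<open>i\<close>, so \<open>u 1 h\<close> determines all
  \<open>u i h\<close>. As the idempotents span the distance matrices, these values separate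
  distances.\<close>

lemma u_1_inj:
  assumes h: "h \<le> diam" and l: "l \<le> diam" and eq: "u 1 h = u 1 l"
  shows "h = l"
proof -
  have same: "i \<le> diam \<Longrightarrow> u i h = u i l" for i
  proof (induction i rule: less_induct)
    case (less i)
    show ?case
    proof (cases i)
      case (Suc s)
      have s: "s \<le> diam" using less.prems Suc by simp
      let ?D = "\<lambda>r. u r h - u r l"
      have "(\<Sum>r\<le>diam. \<kappa> 1 s r * ?D r) = u 1 h * u s h - u 1 l * u s l"
        using diam_pos s h l by (simp add: schur_u right_diff_distrib sum_subtractf)
      also have "\<dots> = 0" using less.IH[of s] Suc s eq by simp
      also have "(\<Sum>r\<le>diam. \<kappa> 1 s r * ?D r) = (\<Sum>r\<le>diam. if r = i then \<kappa> 1 s i * ?D i else 0)"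
      proof (rule sum.cong)
        fix r assume r: "r \<in> {..diam}"
        moreover have "r < i \<or> r = i \<or> s + 1 < r" using Suc by linarith
        ultimately show "\<kappa> 1 s r * ?D r = (if r = i then \<kappa> 1 s i * ?D i else 0)"
          using less.IH[of r] \<kappa>_eq_0_iff[of r 1 s] T_far1[of s r] s Suc by auto
      qed simp
      finally have "\<kappa> 1 s i * ?D i = 0" using less.prems by simp
      moreover have "\<kappa> 1 s i \<noteq> 0" using T_next[of s] less.prems Suc \<kappa>_eq_0_iff by simp
      ultimately show ?thesis by simp
    qed (simp add: u_0)
  qed
  obtain c where c: "\<And>x y. of_bool (dist_G x y = h) = (\<Sum>i\<le>diam. c i * e i x y)"
    using idempotents_span[of "\<lambda>t. of_bool (t = h)"] by blast
  obtain x y x' y' where d: "dist_G x y = h" "dist_G x' y' = l" using ex_dist h l by metis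
  have "(\<Sum>i\<le>diam. c i * e i x y) = (\<Sum>i\<le>diam. c i * e i x' y')"
    by (rule sum.cong) (simp_all add: e_u d same)
  then have "of_bool (h = h) = (of_bool (l = h) :: real)" unfolding c[symmetric] d .
  then show ?thesis by (simp split: if_splits)
qed

text \<open>With \<open>i = j + 1\<close>, the vanishing of \<open>T i 1 i\<close> makes \<open>Dg u\<close> and \<open>Dg y\<close> commute past the idempotents
  between \<open>E (i - 1)\<close> and \<open>E (i + 1)\<close>, so that the expansion of \<open>Dg y\<close> into squares can be
  moved to a place where it meets \<open>E (i + 1) ** Dg y ** E (i - 1) = 0\<close>.\<close>

lemma dual_a_1_eq_0:
  assumes "1 \<le> j" "j + 2 \<le> diam" "T (j + 1) 1 (j + 1) = 0"
  shows "T 1 1 1 = 0"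
proof (rule ccontr)
  assume nz: "T 1 1 1 \<noteq> 0"
  define P Q R where "P = E (j + 2)" and "Q = E (j + 1)" and "R = E j"
  note D = diam_pos
  \<comment> \<open>From \<open>E (j + 2)\<close> to \<open>E j\<close> in two steps of length at
    most one, the only intermediate index is \<open>j + 1\<close>.\<close>
  have 1: "P ** Dg a ** Dg b ** R = P ** Dg a ** Q ** Dg b ** R" for a b
    unfolding P_def Q_def R_def
  proof (rule insert_idempotent)
    fix l assume "l \<le> diam" "l \<noteq> j + 1"
    moreover then have "l + 1 < j + 2 \<or> j + 1 < l" by linarith
    ultimately show "T (j + 2) 1 l = 0 \<or> T l 1 j = 0"
      using T_far1[of "j + 2" l] T_far1[of l j] assms by auto
  qed (use assms D in auto)
  \<comment> \<open>Between \<open>j + 1\<close> and \<open>j\<close> the intermediate index could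
    be \<open>j\<close> or \<open>j + 1\<close>; the hypothesis on \<open>T\<close> excludes
    \<open>j + 1\<close>.\<close>
  have 2: "Q ** Dg a ** Dg b ** R = Q ** Dg a ** R ** Dg b ** R" for a b
    unfolding Q_def R_def
  proof (rule insert_idempotent)
    fix l assume "l \<le> diam" "l \<noteq> j"
    moreover then have "l + 1 < j + 1 \<or> l = j + 1 \<or> j + 1 < l" by linarith
    ultimately show "T (j + 1) 1 l = 0 \<or> T l 1 j = 0"
      using T_far1[of "j + 1" l] T_far1[of l j] assms by auto
  qed (use assms D in auto)
  have 3: "P ** Dg a ** R = 0" for a
    unfolding P_def R_def using T_far1[of "j + 2" j] assms D by (intro E_Dg_E_eq_0) auto
  note assoc = matrix_mul_assoc
  \<comment> \<open>The factor \<open>Dg a\<close> travels to the right past both copies of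
    \<open>Dg w\<close>: \<open>1\<close> and \<open>2\<close> remove or insert an idempotent, and
    diagonal matrices commute.\<close>
  have move: "P ** Dg a ** Q ** Dg w ** Dg w ** R = P ** Dg w ** Dg w ** R ** Dg a ** R" for a w
  proof -
    have "P ** Dg a ** Q ** Dg w ** Dg w ** R = P ** Dg a ** (Q ** Dg w ** Dg w ** R)"
      by (simp only: assoc)
    also have "\<dots> = P ** Dg a ** Q ** Dg w ** R ** Dg w ** R" unfolding 2 by (simp only: assoc)
    also have "\<dots> = P ** Dg a ** Dg w ** R ** Dg w ** R" unfolding 1 ..
    also have "\<dots> = P ** (Dg a ** Dg w) ** R ** Dg w ** R" by (simp only: assoc)
    also have "\<dots> = P ** Dg w ** Dg a ** R ** Dg w ** R"
      unfolding Dg_commute[of a w] by (simp only: assoc)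
    also have "\<dots> = P ** Dg w ** (Q ** Dg a ** R ** Dg w ** R)" unfolding 1 by (simp only: assoc)
    also have "\<dots> = P ** Dg w ** (Q ** (Dg a ** Dg w) ** R)" unfolding 2[symmetric] by (simp only: assoc)
    also have "\<dots> = P ** Dg w ** (Q ** Dg w ** Dg a ** R)"
      unfolding Dg_commute[of a w] by (simp only: assoc)
    also have "\<dots> = P ** Dg w ** Q ** Dg w ** R ** Dg a ** R" unfolding 2 by (simp only: assoc)
    also have "\<dots> = P ** Dg w ** Dg w ** R ** Dg a ** R" unfolding 1 ..
    finally show ?thesis .
  qed
  have 4: "P ** Dg a ** Q ** Dg y ** R = 0" for a y
  proof -
    have "\<kappa> 1 1 1 *\<^sub>R (P ** Dg a ** Q ** Dg y ** R) = P ** Dg a ** Q ** (\<kappa> 1 1 1 *\<^sub>R Dg y) ** R"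
      by (simp add: scalar_matrix_assoc matrix_scalar_ac)
    also have "\<dots> = (\<Sum>w\<in>UNIV. e 1 w y *\<^sub>R (P ** Dg a ** Q ** Dg w ** Dg w ** R))"
      unfolding Dg_square_sum[OF D]
      by (simp add: matrix_mult_sum_left matrix_mult_sum_right matrix_mul_assoc
        scalar_matrix_assoc matrix_scalar_ac)
    also have "\<dots> = P ** (\<Sum>w\<in>UNIV. e 1 w y *\<^sub>R (Dg w ** Dg w)) ** R ** Dg a ** R"
      unfolding move
      by (simp add: matrix_mult_sum_left matrix_mult_sum_right matrix_mul_assoc
        scalar_matrix_assoc matrix_scalar_ac)
    also have "\<dots> = \<kappa> 1 1 1 *\<^sub>R ((P ** Dg y ** R) ** Dg a ** R)"
      unfolding Dg_square_sum[OF D, symmetric] by (simp add: scalar_matrix_assoc matrix_scalar_ac)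
    also have "\<dots> = 0" unfolding 3 by simp
    finally show ?thesis using nz \<kappa>_eq_0_iff[OF D] by simp
  qed
  \<comment> \<open>With both base points equal to the column index, the zero matrix of
    \<open>4\<close> has as entry a nonzero multiple of the entry of
    \<open>E (j + 2)\<close>.\<close>
  have "e (j + 2) a b = 0" for a b
  proof -
    have "0 = ((P ** Dg b) ** (Q ** Dg b ** R)) $ a $ b"
      using 4[of b b] by (simp add: matrix_mul_assoc)
    also have "\<dots> = (\<Sum>z\<in>UNIV. (P ** Dg b) $ a $ z * (Q ** Dg b ** R) $ z $ b)"
      unfolding matrix_matrix_mult_def[of "P ** Dg b" "Q ** Dg b ** R"] by simp
    also have "\<dots> = \<kappa> 1 j (j + 1) * (\<Sum>z\<in>UNIV. (P ** Dg b) $ a $ z * Q $ z $ b)"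
      unfolding Q_def R_def using assms D
      by (simp add: E_Dg_E_diagonal_entry sum_distrib_left e_def mult_ac)
    also have "(\<Sum>z\<in>UNIV. (P ** Dg b) $ a $ z * Q $ z $ b) = (P ** Dg b ** Q) $ a $ b"
      unfolding matrix_matrix_mult_def[of "P ** Dg b" Q] by simp
    also have "\<dots> = \<kappa> 1 (j + 1) (j + 2) * e (j + 2) a b"
      unfolding P_def Q_def using assms D by (simp add: E_Dg_E_diagonal_entry)
    finally show ?thesis
      using T_next[of j] T_next[of "j + 1"] assms by (simp add: \<kappa>_eq_0_iff)
  qed
  then show False using E_neq_0[of "j + 2"] assms unfolding e_def vec_eq_iff by simp
qed

end

section \<open>Leonard's recurrences\<close>

context idempotents
begin

lemma sum_e_bilinear:
  "(\<Sum>w\<in>UNIV. (\<Sum>i\<le>diam. p i * e i y w) * f w * (\<Sum>j\<le>diam. q j * e j w z))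
    = (\<Sum>i\<le>diam. \<Sum>j\<le>diam. p i * q j * (\<Sum>w\<in>UNIV. e i y w * f w * e j w z))"
proof -
  have "(\<Sum>w\<in>UNIV. (\<Sum>i\<le>diam. p i * e i y w) * f w * (\<Sum>j\<le>diam. q j * e j w z))
    = (\<Sum>w\<in>UNIV. \<Sum>i\<le>diam. \<Sum>j\<le>diam. p i * q j * (e i y w * f w * e j w z))"
    by (simp add: sum_distrib_left sum_distrib_right mult_ac)
  also have "\<dots> = (\<Sum>i\<le>diam. \<Sum>j\<le>diam. \<Sum>w\<in>UNIV. p i * q j * (e i y w * f w * e j w z))"
    by (rule sum_swap3)
  finally show ?thesis by (simp add: sum_distrib_left)
qed

text \<open>The left sides are the entries at distance \<open>t\<close> of the powers of
  \<open>A\<close> with exponents 0 to 3; the right sides are their spectral decompositions.\<close>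

lemma u_power_expansion:
  assumes "t \<le> diam" "1 \<le> diam"
  shows "(if t = 0 then 1 else 0) = (\<Sum>i\<le>diam. u i t)"
    and "(if t = 1 then 1 else 0) = (\<Sum>i\<le>diam. \<theta> i * u i t)"
    and "real (nbrs t 1) = (\<Sum>i\<le>diam. \<theta> i ^ 2 * u i t)"
    and "(\<Sum>l\<le>diam. real (nbrs t l) * real (nbrs l 1)) = (\<Sum>i\<le>diam. \<theta> i ^ 3 * u i t)"
proof -
  have *: "(if s = 1 then 1 else 0) = (\<Sum>i\<le>diam. \<theta> i * u i s)" if "s \<le> diam" for s
  proof -
    obtain x y where xy: "dist_G x y = s" using ex_dist[OF \<open>s \<le> diam\<close>] by blast
    have "(if s = 1 then 1 else 0) = A x y"
      unfolding A_def using gdist_eq_1_iff[of x y] xy by simp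
    then show ?thesis unfolding A_decomp by (simp add: e_u xy)
  qed
  show "(if t = 1 then 1 else 0) = (\<Sum>i\<le>diam. \<theta> i * u i t)" using *[OF assms(1)] .
  have step: "(\<Sum>l\<le>diam. real (nbrs s l) * (\<Sum>i\<le>diam. c i * u i l)) = (\<Sum>i\<le>diam. c i * \<theta> i * u i s)"
    if "s \<le> diam" for s c
  proof -
    have "(\<Sum>l\<le>diam. real (nbrs s l) * (\<Sum>i\<le>diam. c i * u i l))
        = (\<Sum>i\<le>diam. c i * (\<Sum>l\<le>diam. real (nbrs s l) * u i l))"
      unfolding sum_distrib_left by (subst sum.swap) (simp add: mult_ac)
    then show ?thesis using that by (simp add: u_recurrence mult.assoc)
  qed
  have **: "real (nbrs s 1) = (\<Sum>i\<le>diam. \<theta> i ^ 2 * u i s)" if "s \<le> diam" for s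
  proof -
    have "real (nbrs s 1) = (\<Sum>l\<le>diam. real (nbrs s l) * (if l = 1 then 1 else 0))"
      using assms(2) by (simp add: if_distrib[of "\<lambda>t. _ * t"] cong: if_cong)
    also have "\<dots> = (\<Sum>l\<le>diam. real (nbrs s l) * (\<Sum>i\<le>diam. \<theta> i * u i l))"
      by (rule sum.cong) (simp_all only: * atMost_iff)
    also have "\<dots> = (\<Sum>i\<le>diam. \<theta> i * \<theta> i * u i s)" by (rule step[OF that])
    finally show ?thesis by (simp add: power2_eq_square)
  qed
  show "real (nbrs t 1) = (\<Sum>i\<le>diam. \<theta> i ^ 2 * u i t)" using **[OF assms(1)] .
  have "(\<Sum>l\<le>diam. real (nbrs t l) * real (nbrs l 1))
      = (\<Sum>l\<le>diam. real (nbrs t l) * (\<Sum>i\<le>diam. \<theta> i ^ 2 * u i l))"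
    by (rule sum.cong) (simp_all only: ** atMost_iff)
  also have "\<dots> = (\<Sum>i\<le>diam. \<theta> i ^ 2 * \<theta> i * u i t)" by (rule step[OF assms(1)])
  finally show "(\<Sum>l\<le>diam. real (nbrs t l) * real (nbrs l 1)) = (\<Sum>i\<le>diam. \<theta> i ^ 3 * u i t)"
    by (simp add: power2_eq_square power3_eq_cube)
  obtain x y where xy: "dist_G x y = t" using ex_dist[OF assms(1)] by blast
  show "(if t = 0 then 1 else 0) = (\<Sum>i\<le>diam. u i t)"
    using e_sum[of x y] gdist_eq_0_iff[of x y] xy by (simp add: e_u)
qed

lemma u_independent:
  assumes "\<And>t. t \<le> diam \<Longrightarrow> (\<Sum>i\<le>diam. c i * u i t) = (\<Sum>i\<le>diam. d i * u i t)" "h \<le> diam"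
  shows "c h = d h"
proof -
  have *: "(\<Sum>i\<le>diam. c i * e i x y) = (\<Sum>i\<le>diam. d i * e i x y)" for x y
    using assms(1)[OF gdist_le_diam[of x y]] by (simp add: e_u)
  have "c h * M h = d h * M h"
    unfolding sum_e_mult[OF assms(2), symmetric] * ..
  then show ?thesis using M_pos[OF assms(2)] by simp
qed

end

section \<open>The cubic commutator relation\<close>

context q_poly
begin

text \<open>A telescoping sum with \<open>m 0 = 0\<close>, made so that \<open>\<theta> i ^ 2 *
  \<theta> j - \<theta> i * \<theta> j ^ 2 = m i - m j\<close> for adjacent indices.\<close>

definition m :: "nat \<Rightarrow> real" where
  "m i = - (\<Sum>l<i. \<theta> l * \<theta> (Suc l) * (\<theta> l - \<theta> (Suc l)))"

lemma m_Suc: "m i - m (Suc i) = \<theta> i * \<theta> (Suc i) * (\<theta> i - \<theta> (Suc i))"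
  unfolding m_def by simp

text \<open>The entry at distance \<open>t\<close> of the matrix with eigenvalue \<open>m i\<close>
  on \<open>E i\<close>.\<close>

definition \<mu> :: "nat \<Rightarrow> real" where "\<mu> t = (\<Sum>i\<le>diam. m i * u i t)"

text \<open>Entrywise form of \<open>A\<^sup>2 D A - A D A\<^sup>2 = N D - D N\<close> with \<open>D = Dg x\<close> and
  \<open>N = (\<Sum>i\<le>diam. m i *\<^sub>R E i)\<close>; it holds because \<open>E i ** D ** E j\<close> vanishes unless \<open>i\<close>, \<open>j\<close>
  differ by at most one.\<close>

lemma cubic_commutator:
  "(\<Sum>w\<in>UNIV. real (nbrs (dist_G y w) 1) * e 1 w x * A w z)
    - (\<Sum>w\<in>UNIV. A y w * e 1 w x * real (nbrs (dist_G w z) 1))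
    = \<mu> (dist_G y z) * (e 1 z x - e 1 y x)"
proof -
  let ?S = "\<lambda>i j. \<Sum>w\<in>UNIV. e i y w * e 1 w x * e j w z"
  have sq: "real (nbrs (dist_G a b) 1) = (\<Sum>i\<le>diam. \<theta> i ^ 2 * e i a b)" for a b
    using u_power_expansion(3)[OF gdist_le_diam[of a b] diam_pos] by (simp add: e_u)
  have mu: "\<mu> (dist_G a b) = (\<Sum>i\<le>diam. m i * e i a b)" for a b
    unfolding \<mu>_def by (simp add: e_u)
  have id: "(if a = b then 1 else 0) = (\<Sum>i\<le>diam. 1 * e i a b)" for a b
    using e_sum[of a b] by simp
  have 1: "(\<Sum>w\<in>UNIV. real (nbrs (dist_G y w) 1) * e 1 w x * A w z)
      = (\<Sum>i\<le>diam. \<Sum>j\<le>diam. \<theta> i ^ 2 * \<theta> j * ?S i j)"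
    unfolding sq A_decomp by (rule sum_e_bilinear)
  have 2: "(\<Sum>w\<in>UNIV. A y w * e 1 w x * real (nbrs (dist_G w z) 1))
      = (\<Sum>i\<le>diam. \<Sum>j\<le>diam. \<theta> i * \<theta> j ^ 2 * ?S i j)"
    unfolding sq A_decomp by (rule sum_e_bilinear)
  have "\<mu> (dist_G y z) * e 1 z x = (\<Sum>w\<in>UNIV. \<mu> (dist_G y w) * e 1 w x * (if w = z then 1 else 0))"
    by (simp add: if_distrib[of "\<lambda>t. _ * t"] cong: if_cong)
  also have "\<dots> = (\<Sum>i\<le>diam. \<Sum>j\<le>diam. m i * 1 * ?S i j)"
    unfolding mu id by (rule sum_e_bilinear)
  finally have 3: "\<mu> (dist_G y z) * e 1 z x = (\<Sum>i\<le>diam. \<Sum>j\<le>diam. m i * 1 * ?S i j)" .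
  have "\<mu> (dist_G y z) * e 1 y x = (\<Sum>w\<in>UNIV. (if y = w then 1 else 0) * e 1 w x * \<mu> (dist_G w z))"
    by (simp add: if_distrib[of "\<lambda>t. t * _"] cong: if_cong)
  also have "\<dots> = (\<Sum>i\<le>diam. \<Sum>j\<le>diam. 1 * m j * ?S i j)"
    unfolding mu id by (rule sum_e_bilinear)
  finally have 4: "\<mu> (dist_G y z) * e 1 y x = (\<Sum>i\<le>diam. \<Sum>j\<le>diam. 1 * m j * ?S i j)" .
  have pw: "(\<theta> i ^ 2 * \<theta> j - \<theta> i * \<theta> j ^ 2) * ?S i j = (m i - m j) * ?S i j"
    if ij: "i \<le> diam" "j \<le> diam" for i j
  proof -
    consider "i + 1 < j \<or> j + 1 < i" | "i = j" | "j = Suc i" | "i = Suc j" by linarith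
    then show ?thesis
    proof cases
      case 1
      then have "?S i j = 0"
        using krein_triple_zero[of i 1 j y x z] T_far1[of i j] ij diam_pos e_commute[OF ij(1)] by simp
      then show ?thesis by simp
    next
      case 2
      then show ?thesis by (simp add: power2_eq_square)
    next
      case 3
      have "\<theta> i ^ 2 * \<theta> j - \<theta> i * \<theta> j ^ 2 = m i - m j"
        unfolding 3 m_Suc by (simp add: power2_eq_square algebra_simps)
      then show ?thesis by simp
    next
      case 4
      have "\<theta> i ^ 2 * \<theta> j - \<theta> i * \<theta> j ^ 2 = m i - m j"
        unfolding 4 using m_Suc[of j] by (simp add: power2_eq_square algebra_simps)
      then show ?thesis by simp
    qed
  qed
  have "(\<Sum>i\<le>diam. \<Sum>j\<le>diam. (\<theta> i ^ 2 * \<theta> j - \<theta> i * \<theta> j ^ 2) * ?S i j)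
      = (\<Sum>i\<le>diam. \<Sum>j\<le>diam. (m i - m j) * ?S i j)"
    by (intro sum.cong refl pw) auto
  then show ?thesis
    unfolding 1 2 right_diff_distrib 3 4 by (simp add: left_diff_distrib sum_subtractf)
qed

end

locale q_poly4 = q_poly adj E
  for adj :: "'n::finite \<Rightarrow> 'n \<Rightarrow> bool" and E +
  assumes diam4: "diam = 4"
begin

lemma sum_diam: "(\<Sum>i\<le>diam. f i) = f 0 + f 1 + f 2 + f 3 + (f 4 :: real)"
  by (simp add: diam4 eval_nat_numeral)

lemma \<theta>_neq: "i \<le> 4 \<Longrightarrow> j \<le> 4 \<Longrightarrow> i \<noteq> j \<Longrightarrow> \<theta> i \<noteq> \<theta> j"
  using \<theta>_inj diam4 by metis

lemma u_1_neq: "i \<le> 4 \<Longrightarrow> j \<le> 4 \<Longrightarrow> i \<noteq> j \<Longrightarrow> u 1 i \<noteq> u 1 j"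
  using u_1_inj diam4 by metis

lemma nbrs_cubed_3: "(\<Sum>l\<le>diam. real (nbrs 3 l) * real (nbrs l 1)) = real (nbrs 3 2) * real (nbrs 2 1)"
  unfolding sum_diam by (simp add: nbrs_eq_0 diam4)

text \<open>At distance 3 the sums run over the middle vertices of geodesics only. If these have a
  constant distance to \<open>x\<close>, each sum is a dual eigenvalue times the entry
  \<open>c\<^sub>3 * c\<^sub>2\<close> of the cube of \<open>A\<close>.\<close>

lemma cubic_commutator_3:
  assumes yz: "dist_G y z = 3"
    and r: "\<And>w. adj z w \<Longrightarrow> dist_G y w = 2 \<Longrightarrow> dist_G w x = r"
    and s: "\<And>w. adj y w \<Longrightarrow> dist_G w z = 2 \<Longrightarrow> dist_G w x = s"
  shows "real (nbrs 3 2) * real (nbrs 2 1) * (u 1 r - u 1 s)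
    = \<mu> 3 * (u 1 (dist_G z x) - u 1 (dist_G y x))"
proof -
  have d1: "1 \<le> diam" using diam4 by simp
  \<comment> \<open>A neighbour at distance 3 from \<open>b\<close> puts \<open>a\<close> at
    distance at least 2, while an entry of the square of \<open>A\<close> is nonzero only up to
    distance 2.\<close>
  have away: "nbrs (dist_G a b) 1 = 0" if "adj a c" "dist_G c b = 3" "dist_G a b \<noteq> 2" for a b c
    using gdist_adj_bounds[OF that(1), of b] that nbrs_eq_0[of "dist_G a b" 1] gdist_le_diam[of a b] by auto
  have "(\<Sum>w\<in>UNIV. real (nbrs (dist_G y w) 1) * e 1 w x * A w z)
      = (\<Sum>w\<in>UNIV. u 1 r * (A z w * real (nbrs (dist_G w y) 1)))"
  proof (rule sum.cong[OF refl])
    fix w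
    show "real (nbrs (dist_G y w) 1) * e 1 w x * A w z = u 1 r * (A z w * real (nbrs (dist_G w y) 1))"
    proof (cases "adj z w")
      case True
      then show ?thesis
        using away[OF adj_sym[OF True], of y] r[OF True] yz d1
        by (cases "dist_G y w = 2") (simp_all add: e_u A_commute[of w z] gdist_commute[of _ y])
    qed (auto simp: A_def dest: adj_sym)
  qed
  also have "\<dots> = u 1 r * (real (nbrs 3 2) * real (nbrs 2 1))"
    using sum_nbrs[of z y 3 "\<lambda>l. real (nbrs l 1)"] yz
    by (simp add: sum_distrib_left[symmetric] nbrs_cubed_3[unfolded One_nat_def] gdist_commute[of z y])
  finally have 1: "(\<Sum>w\<in>UNIV. real (nbrs (dist_G y w) 1) * e 1 w x * A w z)
      = u 1 r * (real (nbrs 3 2) * real (nbrs 2 1))" .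
  have "(\<Sum>w\<in>UNIV. A y w * e 1 w x * real (nbrs (dist_G w z) 1))
      = (\<Sum>w\<in>UNIV. u 1 s * (A y w * real (nbrs (dist_G w z) 1)))"
  proof (rule sum.cong[OF refl])
    fix w
    show "A y w * e 1 w x * real (nbrs (dist_G w z) 1) = u 1 s * (A y w * real (nbrs (dist_G w z) 1))"
    proof (cases "adj y w")
      case True
      then show ?thesis
        using away[OF adj_sym[OF True], of z] s[OF True] yz d1
        by (cases "dist_G w z = 2") (simp_all add: e_u)
    qed (simp add: A_def)
  qed
  also have "\<dots> = u 1 s * (real (nbrs 3 2) * real (nbrs 2 1))"
    using sum_nbrs[of y z 3 "\<lambda>l. real (nbrs l 1)"] yz
    by (simp add: sum_distrib_left[symmetric] nbrs_cubed_3[unfolded One_nat_def])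
  finally have 2: "(\<Sum>w\<in>UNIV. A y w * e 1 w x * real (nbrs (dist_G w z) 1))
      = u 1 s * (real (nbrs 3 2) * real (nbrs 2 1))" .
  show ?thesis
    using cubic_commutator[of y x z, unfolded 1 2 yz, unfolded e_u[OF d1]] by (simp add: algebra_simps)
qed

text \<open>Both sums of the commutator relation are empty at distance 4, while the dual eigenvalues
  at 4 and 0 differ.\<close>

lemma \<mu>_4: "\<mu> 4 = 0"
proof -
  obtain x :: 'n and z where xz: "dist_G x z = 4" using ex_dist[of 4] diam4 by (metis order_refl)
  have d1: "1 \<le> diam" using diam4 by simp
  have "real (nbrs (dist_G x w) 1) * e 1 w x * A w z = 0" for w
    using gdist_adj_bounds[of w z x] nbrs_eq_0[of "dist_G x w" 1] gdist_le_diam[of x w] xz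
    by (cases "adj w z") (auto simp: A_def gdist_commute[of _ x])
  moreover have "A x w * e 1 w x * real (nbrs (dist_G w z) 1) = 0" for w
    using gdist_adj_bounds[of x w z] nbrs_eq_0[of "dist_G w z" 1] gdist_le_diam[of w z] xz
    by (cases "adj x w") (auto simp: A_def)
  ultimately have "\<mu> 4 * (e 1 z x - e 1 x x) = 0"
    using cubic_commutator[of x x z] xz by (simp only: sum.neutral_const diff_self)
  then show ?thesis
    using u_1_neq[of 4 0] by (simp add: e_u[OF d1, unfolded One_nat_def] xz gdist_commute[of z x])
qed

text \<open>The recurrences of Leonard's theorem, with \<open>\<beta> + 1 = 1 / m\<close>.\<close>

lemma leonard_recurrence:
  obtains m where "m \<noteq> 0"
    "\<theta> 1 - \<theta> 2 = m * (\<theta> 0 - \<theta> 3)" "\<theta> 2 - \<theta> 3 = m * (\<theta> 1 - \<theta> 4)"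
    "u 1 1 - u 1 2 = m * (u 1 0 - u 1 3)" "u 1 2 - u 1 3 = m * (u 1 1 - u 1 4)"
proof -
  define C where "C = real (nbrs 3 2) * real (nbrs 2 1)"
  have C: "C > 0"
    unfolding C_def using nbrs_pred_pos[of 2] nbrs_pred_pos[of 1] diam4 by (simp add: eval_nat_numeral)
  \<comment> \<open>The matrix with entries \<open>\<mu>\<close> is a cubic polynomial in
    \<open>A\<close>: the coefficients \<open>n3\<close>, \<open>n2\<close>, \<open>n1\<close>,
    \<open>n0\<close> are solved for at distances 3, 2, 1, 0, and distance 4 agrees by
    \<open>\<mu>_4\<close>.\<close>
  define n3 where "n3 = \<mu> 3 / C"
  have b2: "real (nbrs 2 1) \<noteq> 0" using nbrs_pred_pos[of 1] diam4 by (simp add: eval_nat_numeral)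
  define c3 where "c3 t = (\<Sum>l\<le>diam. real (nbrs t l) * real (nbrs l 1))" for t
  define n2 where "n2 = (\<mu> 2 - n3 * c3 2) / real (nbrs 2 1)"
  define n1 where "n1 = \<mu> 1 - n3 * c3 1 - n2 * real (nbrs 1 1)"
  define n0 where "n0 = \<mu> 0 - n3 * c3 0 - n2 * real (nbrs 0 1)"
  have c33: "c3 3 = C" unfolding c3_def C_def by (rule nbrs_cubed_3)
  have c34: "c3 4 = 0" unfolding c3_def sum_diam by (simp add: nbrs_eq_0 diam4)
  have far: "nbrs 3 1 = 0" "nbrs 4 1 = 0" by (simp_all add: nbrs_eq_0 diam4)
  have mu: "\<mu> t = n3 * c3 t + n2 * real (nbrs t 1) + n1 * (if t = 1 then 1 else 0) + n0 * (if t = 0 then 1 else 0)"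
    if t: "t \<le> diam" for t
  proof -
    consider "t = 0" | "t = 1" | "t = 2" | "t = 3" | "t = 4" using t diam4 by linarith
    then show ?thesis
    proof cases
      case 4
      then show ?thesis using C far by (simp add: c33 n3_def)
    next
      case 5
      then show ?thesis using far by (simp add: c34 \<mu>_4)
    qed (use b2 in \<open>simp_all add: n0_def n1_def n2_def\<close>)
  qed
  have m_cubic: "m i = n3 * \<theta> i ^ 3 + n2 * \<theta> i ^ 2 + n1 * \<theta> i + n0" if "i \<le> diam" for i
  proof (rule u_independent[OF _ that])
    fix t assume t: "t \<le> diam"
    show "(\<Sum>i\<le>diam. m i * u i t) = (\<Sum>i\<le>diam. (n3 * \<theta> i ^ 3 + n2 * \<theta> i ^ 2 + n1 * \<theta> i + n0) * u i t)"
      using mu[OF t] unfolding \<mu>_def c3_def u_power_expansion[OF t diam_pos]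
      by (simp add: sum_distrib_left sum.distrib distrib_right mult.assoc)
  qed
  \<comment> \<open>The difference \<open>m i - m (Suc i)\<close> is computed from the definition
    and from the cubic, then divided by \<open>\<theta> i - \<theta> (Suc i)\<close>.\<close>
  have pair: "\<theta> i * \<theta> (Suc i) = n3 * (\<theta> i ^ 2 + \<theta> i * \<theta> (Suc i) + \<theta> (Suc i) ^ 2) + n2 * (\<theta> i + \<theta> (Suc i)) + n1"
    if "i \<le> 3" for i
  proof -
    have "(\<theta> i - \<theta> (Suc i)) * (\<theta> i * \<theta> (Suc i)) =
       (\<theta> i - \<theta> (Suc i)) * (n3 * (\<theta> i ^ 2 + \<theta> i * \<theta> (Suc i) + \<theta> (Suc i) ^ 2) + n2 * (\<theta> i + \<theta> (Suc i)) + n1)"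
    proof -
      have "m i = n3 * \<theta> i ^ 3 + n2 * \<theta> i ^ 2 + n1 * \<theta> i + n0"
        "m (Suc i) = n3 * \<theta> (Suc i) ^ 3 + n2 * \<theta> (Suc i) ^ 2 + n1 * \<theta> (Suc i) + n0"
        using m_cubic that diam4 by simp_all
      then show ?thesis using m_Suc[of i] by algebra
    qed
    then show ?thesis using \<theta>_neq[of i "Suc i"] that by simp
  qed
  \<comment> \<open>Two consecutive instances of \<open>pair\<close> are subtracted and divided by
    \<open>\<theta> i - \<theta> (Suc (Suc i))\<close>. The differences of these relations are the
    recurrences for \<theta> with constant \<open>n3\<close>.\<close>
  have triple: "\<theta> (Suc i) = n3 * (\<theta> i + \<theta> (Suc i) + \<theta> (Suc (Suc i))) + n2" if "i \<le> 2" for i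
  proof -
    have "(\<theta> i - \<theta> (Suc (Suc i))) * \<theta> (Suc i) =
      (\<theta> i - \<theta> (Suc (Suc i))) * (n3 * (\<theta> i + \<theta> (Suc i) + \<theta> (Suc (Suc i))) + n2)"
      using pair[of i] pair[of "Suc i"] that by simp algebra
    then show ?thesis using \<theta>_neq[of i "Suc (Suc i)"] that by simp
  qed
  have th: "\<theta> 1 - \<theta> 2 = n3 * (\<theta> 0 - \<theta> 3)" "\<theta> 2 - \<theta> 3 = n3 * (\<theta> 1 - \<theta> 4)"
    using triple[of 0] triple[of 1] triple[of 2] by (simp_all add: eval_nat_numeral algebra_simps)
  obtain x :: 'n and z where xz: "dist_G x z = 4" using ex_dist[of 4] diam4 by (metis order_refl)
  obtain y where y: "dist_G x y = 1" "dist_G y z = 3" using geodesic_point[of 1 x z] xz by auto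
  \<comment> \<open>Dual recurrences: first the base point is \<open>y\<close> itself, an end of the
    pair at distance 3.\<close>
  have "C * (u 1 2 - u 1 1) = \<mu> 3 * (u 1 (dist_G z y) - u 1 (dist_G y y))"
    unfolding C_def
  proof (rule cubic_commutator_3[OF y(2)])
    fix w assume "adj y w"
    then show "dist_G w y = 1" using gdist_eq_1_iff[of y w] gdist_commute by metis
  qed (simp add: gdist_commute[of _ y])
  then have 1: "u 1 1 - u 1 2 = n3 * (u 1 0 - u 1 3)"
    using C y(2) by (simp add: n3_def gdist_commute[of z y] field_simps)
  \<comment> \<open>Now the base point is \<open>x\<close>, which prolongs the geodesic from
    \<open>z\<close> to \<open>y\<close> to length 4 and thereby forces the distances 3 and
    2.\<close>
  have "C * (u 1 3 - u 1 2) = \<mu> 3 * (u 1 (dist_G z x) - u 1 (dist_G y x))"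
    unfolding C_def
  proof (rule cubic_commutator_3[OF y(2)])
    fix w assume w: "adj z w" "dist_G y w = 2"
    then show "dist_G w x = 3"
      using gdist_adj_bounds[OF w(1), of x] gdist_triangle[of x w y] y xz gdist_commute[of x] by simp
  next
    fix w assume w: "adj y w" "dist_G w z = 2"
    then show "dist_G w x = 2"
      using gdist_adj_bounds[OF w(1), of x] gdist_triangle[of x z w] y xz gdist_commute[of x] by simp
  qed
  then have 2: "u 1 2 - u 1 3 = n3 * (u 1 1 - u 1 4)"
    using C y(1) xz by (simp add: n3_def gdist_commute[of _ x] field_simps)
  have "n3 \<noteq> 0" using th(1) \<theta>_neq[of 1 2] by auto
  then show ?thesis using that th 1 2 by blast
qed

end

section \<open>The dual intersection numbers\<close>

context q_poly4
begin

text \<open>A nonzero term needs \<open>l\<close> within one of both \<open>i\<close> and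
  \<open>i + 1\<close>, which leaves \<open>l = i\<close> and \<open>l = i + 1\<close>. Symmetry of
  the triple sum then brings both terms to a common factor.\<close>

lemma schur_sum_neighbours:
  assumes "i < 4"
  shows "(\<Sum>l\<le>diam. \<kappa> 1 (Suc i) l * c l * (\<Sum>z\<in>UNIV. e l z x * e 1 z x * e i z x))
    = (\<kappa> 1 i i * c i + \<kappa> 1 (Suc i) (Suc i) * c (Suc i))
        * (\<Sum>z\<in>UNIV. e (Suc i) z x * e 1 z x * e i z x)"
proof -
  let ?t = "\<lambda>l i. \<Sum>z\<in>UNIV. e l z x * e 1 z x * e i z x"
  let ?h = "Suc i"
  have ih: "i \<le> diam" "?h \<le> diam" "1 \<le> diam" using assms diam4 by auto
  have t: "?t l i = \<kappa> 1 i l * u l 0" if "l \<le> diam" "i \<le> diam" for l i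
  proof -
    have "?t l i = (\<Sum>z\<in>UNIV. e l x z * (e 1 z x * e i z x))"
      by (rule sum.cong[OF refl]) (metis e_commute mult.assoc that(1))
    also have "\<dots> = \<kappa> 1 i l * e l x x" by (rule schur_project[OF ih(3) that(2,1)])
    finally show ?thesis unfolding e_u[OF that(1)] gdist_refl .
  qed
  have sym: "?t l i = ?t i l" for l i by (simp add: mult_ac)
  have "(\<Sum>l\<le>diam. \<kappa> 1 ?h l * c l * ?t l i) = (\<Sum>l\<in>{i, ?h}. \<kappa> 1 ?h l * c l * ?t l i)"
  proof (rule sum.mono_neutral_right)
    show "\<forall>l\<in>{..diam} - {i, ?h}. \<kappa> 1 ?h l * c l * ?t l i = 0"
    proof
      fix l assume l: "l \<in> {..diam} - {i, ?h}"
      then have "l + 1 < ?h \<or> i + 1 < l" by auto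
      then show "\<kappa> 1 ?h l * c l * ?t l i = 0"
        using T_far1[of i l] T_far1[of ?h l] l ih t[of l i] by (auto simp: \<kappa>_eq_0_iff)
    qed
  qed (use ih in auto)
  also have "\<dots> = \<kappa> 1 ?h i * c i * ?t i i + \<kappa> 1 ?h ?h * c ?h * ?t ?h i" by simp
  also have "?t i i = \<kappa> 1 i i * u i 0" by (rule t[OF ih(1,1)])
  also have "\<kappa> 1 ?h i * c i * (\<kappa> 1 i i * u i 0) = \<kappa> 1 i i * c i * ?t ?h i"
    using t[OF ih(1,2)] sym[of ?h i] by simp
  finally show ?thesis by (simp add: algebra_simps)
qed

lemma schur_2_expansion:
  "e 1 z x * e 1 z x = \<kappa> 1 1 0 * e 0 z x + \<kappa> 1 1 1 * e 1 z x + \<kappa> 1 1 2 * e 2 z x"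
proof -
  have "\<kappa> 1 1 3 = 0" "\<kappa> 1 1 4 = 0"
    using T_far[of 1 1 3] T_far[of 1 1 4] diam4 by (simp_all add: \<kappa>_eq_0_iff)
  then show ?thesis using schur[OF diam_pos diam_pos, of z x] unfolding sum_diam by simp
qed

text \<open>Comparison of the coefficients of \<open>E (i + 1)\<close> in the second Askey-Wilson relation.\<close>

lemma dual_a_relation:
  obtains m g where "m \<noteq> 0"
    "\<theta> 1 - \<theta> 2 = m * (\<theta> 0 - \<theta> 3)" "\<theta> 2 - \<theta> 3 = m * (\<theta> 1 - \<theta> 4)"
    "\<forall>i<4. m * (\<kappa> 1 i i + \<kappa> 1 (Suc i) (Suc i)) * (\<theta> i + \<theta> (Suc i))
      + (m - 1) * (\<kappa> 1 i i * \<theta> i + \<kappa> 1 (Suc i) (Suc i) * \<theta> (Suc i)) - g * (\<theta> i + \<theta> (Suc i))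
      = (m * (\<theta> 0 + \<theta> 1 + \<theta> 2) - \<theta> 1) * (\<kappa> 1 i i + \<kappa> 1 (Suc i) (Suc i))
        + m * \<kappa> 1 1 1 * (\<theta> 1 - \<theta> 2) - g * (\<theta> 0 + \<theta> 1)"
proof -
  obtain m where m: "m \<noteq> 0"
    and th: "\<theta> 1 - \<theta> 2 = m * (\<theta> 0 - \<theta> 3)" "\<theta> 2 - \<theta> 3 = m * (\<theta> 1 - \<theta> 4)"
    and v: "u 1 1 - u 1 2 = m * (u 1 0 - u 1 3)" "u 1 2 - u 1 3 = m * (u 1 1 - u 1 4)"
    by (rule leonard_recurrence)
  \<comment> \<open>The symmetric polynomial \<open>\<Phi>\<close> is to vanish at consecutive dual
    eigenvalues: \<open>\<rho>\<close> is chosen for the pair 0, 1 and \<open>g\<close> for the step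
    to 1, 2; Leonard's recurrence carries this on to the pairs 2, 3 and 3, 4.\<close>
  define g where "g = m * (u 1 0 + u 1 1 + u 1 2) - u 1 1"
  define \<rho> where "\<rho> = m * (u 1 0 ^ 2 + u 1 0 * u 1 1 + u 1 1 ^ 2) - u 1 0 * u 1 1 - g * (u 1 0 + u 1 1)"
  define \<Phi> where "\<Phi> a b = m * (a ^ 2 + a * b + b ^ 2) - a * b - g * (a + b) - \<rho>" for a b
  have \<Phi>_commute: "\<Phi> a b = \<Phi> b a" for a b unfolding \<Phi>_def by (simp add: algebra_simps)
  have p0: "\<Phi> (u 1 0) (u 1 1) = 0" unfolding \<Phi>_def \<rho>_def by simp
  have p1: "\<Phi> (u 1 1) (u 1 2) = 0" using p0 g_def unfolding \<Phi>_def by algebra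
  have p2: "\<Phi> (u 1 2) (u 1 3) = 0" using p1 g_def v(1) unfolding \<Phi>_def by algebra
  have p3: "\<Phi> (u 1 3) (u 1 4) = 0" using p2 g_def v unfolding \<Phi>_def by algebra
  have consecutive: "\<Phi> (u 1 i) (u 1 (Suc i)) = 0" if i: "i < 4" for i
  proof -
    consider "i = 0" | "i = 1" | "i = 2" | "i = 3" using i by linarith
    then show ?thesis using p0 p1 p2 p3 by cases (simp_all add: eval_nat_numeral)
  qed
  fix x :: 'n
  define W where "W i z = e i z x" for i z
  have W_u: "W i z = u i (dist_G z x)" if "i \<le> 4" for i z
    unfolding W_def using e_u that diam4 by simp
  have \<Phi>_adj: "\<Phi> (W 1 z) (W 1 w) = 0" if "adj z w" "dist_G z x \<noteq> dist_G w x" for z w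
  proof -
    have "dist_G w x = Suc (dist_G z x) \<or> dist_G z x = Suc (dist_G w x)"
      using gdist_adj_bounds[OF that(1), of x] that(2) by linarith
    then show ?thesis
      using consecutive[of "dist_G z x"] consecutive[of "dist_G w x"] \<Phi>_commute
        gdist_le_diam[of z x] gdist_le_diam[of w x] diam4
      by (auto simp: W_u)
  qed
  define \<zeta> where "\<zeta> z = (\<Sum>w\<in>UNIV. A z w * \<Phi> (W 1 z) (W 1 w))" for z
  \<comment> \<open>By \<open>\<Phi>_adj\<close> only neighbours at the same distance from
    \<open>x\<close> contribute, and there \<open>W i w = W i z\<close>; so weighting
    \<open>A\<close> by \<open>\<Phi>\<close> gives an operator that acts on the \<open>W i\<close>
    as the diagonal \<open>\<zeta>\<close>.\<close>
  have act: "(\<Sum>w\<in>UNIV. A z w * \<Phi> (W 1 z) (W 1 w) * W i w) = \<zeta> z * W i z" if "i \<le> 4" for i z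
    unfolding \<zeta>_def sum_distrib_right
  proof (rule sum.cong[OF refl])
    fix w
    show "A z w * \<Phi> (W 1 z) (W 1 w) * W i w = A z w * \<Phi> (W 1 z) (W 1 w) * W i z"
      using \<Phi>_adj[of z w] W_u[OF that] by (cases "dist_G z x = dist_G w x"; cases "adj z w") (simp_all add: A_def)
  qed
  have eig: "(\<Sum>w\<in>UNIV. A z w * W i w) = \<theta> i * W i z" if "i \<le> 4" for i z
    unfolding W_def using A_eigen that diam4 by simp
  define L1 where "L1 i z = (\<Sum>w\<in>UNIV. A z w * (W 1 w * W i w))" for i z
  define L2 where "L2 i z = (\<Sum>w\<in>UNIV. A z w * (W 1 w ^ 2 * W i w))" for i z
  have expand: "\<zeta> z * W i z = m * (\<theta> i * W 1 z ^ 2 * W i z + W 1 z * L1 i z + L2 i z)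
      - W 1 z * L1 i z - g * (\<theta> i * W 1 z * W i z + L1 i z) - \<rho> * \<theta> i * W i z"
    if "i \<le> 4" for i z
  proof -
    have "A z w * \<Phi> (W 1 z) (W 1 w) * W i w =
        (m * W 1 z ^ 2 - g * W 1 z - \<rho>) * (A z w * W i w)
        + ((m - 1) * W 1 z - g) * (A z w * (W 1 w * W i w)) + m * (A z w * (W 1 w ^ 2 * W i w))" for w
      unfolding \<Phi>_def by (simp add: algebra_simps power2_eq_square)
    then have "\<zeta> z * W i z = (m * W 1 z ^ 2 - g * W 1 z - \<rho>) * (\<theta> i * W i z)
        + ((m - 1) * W 1 z - g) * L1 i z + m * L2 i z"
      unfolding act[OF that, symmetric] L1_def L2_def eig[OF that, symmetric]
      by (simp add: sum.distrib sum_distrib_left)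
    then show ?thesis by (simp add: algebra_simps)
  qed
  define G where "G = m * (\<theta> 0 + \<theta> 1 + \<theta> 2) - \<theta> 1"
  define \<omega> where "\<omega> = m * \<kappa> 1 1 1 * (\<theta> 1 - \<theta> 2) - g * (\<theta> 0 + \<theta> 1)"
  define \<epsilon> where "\<epsilon> = 1 / real CARD('n)"
  have W0: "W 0 z = \<epsilon>" for z unfolding W_def \<epsilon>_def by (rule e_0)
  have \<epsilon>: "\<epsilon> \<noteq> 0" unfolding \<epsilon>_def by simp
  have W1sq: "W 1 z ^ 2 = \<kappa> 1 1 0 * W 0 z + \<kappa> 1 1 1 * W 1 z + \<kappa> 1 1 2 * W 2 z" for z
    unfolding W_def power2_eq_square by (rule schur_2_expansion)
  \<comment> \<open>The case \<open>i = 0\<close>, where \<open>W 0\<close> is constant, evaluates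
    \<open>\<zeta>\<close> as a quadratic polynomial in \<open>W 1\<close>.\<close>
  obtain \<eta> where \<zeta>: "\<And>z. \<zeta> z = G * W 1 z ^ 2 + \<omega> * W 1 z + \<eta>"
  proof
    fix z
    have "L1 0 z = \<epsilon> * (\<Sum>w\<in>UNIV. A z w * W 1 w)"
      unfolding L1_def W0 by (simp add: sum_distrib_left mult_ac)
    then have 1: "L1 0 z = \<epsilon> * \<theta> 1 * W 1 z" by (simp add: eig)
    have "L2 0 z = \<epsilon> * (\<Sum>w\<in>UNIV. \<kappa> 1 1 0 * (A z w * W 0 w) + \<kappa> 1 1 1 * (A z w * W 1 w) + \<kappa> 1 1 2 * (A z w * W 2 w))"
      unfolding L2_def W1sq unfolding W0 by (simp add: sum_distrib_left algebra_simps)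
    also have "\<dots> = \<epsilon> * (\<kappa> 1 1 0 * (\<theta> 0 * W 0 z) + \<kappa> 1 1 1 * (\<theta> 1 * W 1 z) + \<kappa> 1 1 2 * (\<theta> 2 * W 2 z))"
      by (simp add: sum.distrib sum_distrib_left[symmetric] eig)
    also have "\<dots> = \<epsilon> * (\<theta> 2 * W 1 z ^ 2 + \<kappa> 1 1 1 * (\<theta> 1 - \<theta> 2) * W 1 z + \<kappa> 1 1 0 * (\<theta> 0 - \<theta> 2) * \<epsilon>)"
      unfolding W1sq W0 by (simp add: algebra_simps)
    finally have 2: "L2 0 z = \<epsilon> * (\<theta> 2 * W 1 z ^ 2 + \<kappa> 1 1 1 * (\<theta> 1 - \<theta> 2) * W 1 z + \<kappa> 1 1 0 * (\<theta> 0 - \<theta> 2) * \<epsilon>)" .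
    have "\<epsilon> * \<zeta> z = \<epsilon> * (G * W 1 z ^ 2 + \<omega> * W 1 z + (m * \<kappa> 1 1 0 * (\<theta> 0 - \<theta> 2) * \<epsilon> - \<rho> * \<theta> 0))"
      using expand[of 0 z] unfolding 1 2 W0 G_def \<omega>_def by (simp add: algebra_simps power2_eq_square)
    then show "\<zeta> z = G * W 1 z ^ 2 + \<omega> * W 1 z + (m * \<kappa> 1 1 0 * (\<theta> 0 - \<theta> 2) * \<epsilon> - \<rho> * \<theta> 0)"
      using \<epsilon> by simp
  qed
  have rel: "m * (\<kappa> 1 i i + \<kappa> 1 (Suc i) (Suc i)) * (\<theta> i + \<theta> (Suc i))
      + (m - 1) * (\<kappa> 1 i i * \<theta> i + \<kappa> 1 (Suc i) (Suc i) * \<theta> (Suc i)) - g * (\<theta> i + \<theta> (Suc i))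
      = G * (\<kappa> 1 i i + \<kappa> 1 (Suc i) (Suc i)) + \<omega>" if i: "i < 4" for i
  proof -
    let ?h = "Suc i" and ?q = "\<kappa> 1 i i" and ?r = "\<kappa> 1 (Suc i) (Suc i)"
    have ih: "i \<le> 4" "?h \<le> 4" "i \<le> diam" "?h \<le> diam" using i diam4 by auto
    \<comment> \<open>The relation for \<open>W i\<close> is paired with \<open>W (Suc i)\<close>;
      the common factor \<open>\<tau>\<close> is nonzero because \<open>\<kappa> 1 i (Suc i)\<close>
      is.\<close>
    define \<tau> where "\<tau> = (\<Sum>z\<in>UNIV. W ?h z * W 1 z * W i z)"
    have "\<tau> = (\<Sum>z\<in>UNIV. e ?h x z * (e 1 z x * e i z x))"
      unfolding \<tau>_def W_def by (rule sum.cong[OF refl]) (metis e_commute mult.assoc ih(4))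
    also have "\<dots> = \<kappa> 1 i ?h * e ?h x x" by (rule schur_project[OF diam_pos ih(3,4)])
    finally have "\<tau> = \<kappa> 1 i ?h * u ?h 0" unfolding e_u[OF ih(4)] gdist_refl .
    then have \<tau>: "\<tau> \<noteq> 0"
      using T_next[of i] ih u_0_pos[OF ih(4)] by (simp add: \<kappa>_eq_0_iff)
    have mult: "W ?h z * W 1 z = (\<Sum>l\<le>diam. \<kappa> 1 ?h l * W l z)" for z
      unfolding W_def using schur[OF diam_pos ih(4), of z x] by (simp add: mult.commute)
    have neigh: "(\<Sum>l\<le>diam. \<kappa> 1 ?h l * c l * (\<Sum>z\<in>UNIV. W l z * W 1 z * W i z))
        = (?q * c i + ?r * c ?h) * \<tau>" for c
      unfolding W_def \<tau>_def by (rule schur_sum_neighbours[OF i])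
    define X2 where "X2 = (\<Sum>z\<in>UNIV. W ?h z * (W 1 z ^ 2 * W i z))"
    define X3 where "X3 = (\<Sum>z\<in>UNIV. W ?h z * (W 1 z * L1 i z))"
    have "X2 = (\<Sum>z\<in>UNIV. (W ?h z * W 1 z) * (W 1 z * W i z))"
      unfolding X2_def by (simp add: power2_eq_square mult_ac)
    also have "\<dots> = (\<Sum>z\<in>UNIV. \<Sum>l\<le>diam. \<kappa> 1 ?h l * 1 * (W l z * W 1 z * W i z))"
      unfolding mult sum_distrib_right by (simp add: mult_ac)
    also have "\<dots> = (\<Sum>l\<le>diam. \<kappa> 1 ?h l * 1 * (\<Sum>z\<in>UNIV. W l z * W 1 z * W i z))"
      unfolding sum_distrib_left by (rule sum.swap)
    finally have X2: "X2 = (?q + ?r) * \<tau>" unfolding neigh by simp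
    have adjoint: "(\<Sum>z\<in>UNIV. W l z * (\<Sum>w\<in>UNIV. A z w * f w)) = \<theta> l * (\<Sum>w\<in>UNIV. W l w * f w)"
      if "l \<le> diam" for l f
    proof -
      have "(\<Sum>z\<in>UNIV. W l z * (\<Sum>w\<in>UNIV. A z w * f w)) = (\<Sum>w\<in>UNIV. \<Sum>z\<in>UNIV. A w z * W l z * f w)"
        unfolding sum_distrib_left by (subst sum.swap) (simp add: A_commute mult_ac)
      also have "\<dots> = (\<Sum>w\<in>UNIV. \<theta> l * W l w * f w)"
        using eig[of l] that diam4 by (simp add: sum_distrib_right[symmetric])
      finally show ?thesis by (simp add: sum_distrib_left mult.assoc)
    qed
    have "X3 = (\<Sum>z\<in>UNIV. (W ?h z * W 1 z) * L1 i z)"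
      unfolding X3_def by (simp add: mult_ac)
    also have "\<dots> = (\<Sum>z\<in>UNIV. \<Sum>l\<le>diam. \<kappa> 1 ?h l * (W l z * L1 i z))"
      unfolding mult sum_distrib_right by (simp add: mult_ac)
    also have "\<dots> = (\<Sum>l\<le>diam. \<kappa> 1 ?h l * (\<Sum>z\<in>UNIV. W l z * L1 i z))"
      unfolding sum_distrib_left by (rule sum.swap)
    also have "\<dots> = (\<Sum>l\<le>diam. \<kappa> 1 ?h l * \<theta> l * (\<Sum>z\<in>UNIV. W l z * W 1 z * W i z))"
      unfolding L1_def by (rule sum.cong) (simp_all add: adjoint mult.assoc)
    finally have X3: "X3 = (?q * \<theta> i + ?r * \<theta> ?h) * \<tau>" unfolding neigh .
    have L1: "(\<Sum>z\<in>UNIV. W ?h z * L1 i z) = \<theta> ?h * \<tau>"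
      unfolding L1_def \<tau>_def by (simp add: adjoint[OF ih(4)] mult.assoc)
    have L2: "(\<Sum>z\<in>UNIV. W ?h z * L2 i z) = \<theta> ?h * X2"
      unfolding L2_def X2_def by (rule adjoint[OF ih(4)])
    have orth: "(\<Sum>z\<in>UNIV. W ?h z * W i z) = 0"
      unfolding W_def using e_mult[OF ih(4,3), of x x] e_commute[OF ih(4)] by simp
    have "(\<Sum>z\<in>UNIV. W ?h z * (\<zeta> z * W i z)) = (\<Sum>z\<in>UNIV. W ?h z * ((G * W 1 z ^ 2 + \<omega> * W 1 z + \<eta>) * W i z))"
      unfolding \<zeta> ..
    also have "\<dots> = (\<Sum>z\<in>UNIV. G * (W ?h z * (W 1 z ^ 2 * W i z)) + \<omega> * (W ?h z * W 1 z * W i z) + \<eta> * (W ?h z * W i z))"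
      by (rule sum.cong) (simp_all add: algebra_simps)
    also have "\<dots> = G * X2 + \<omega> * \<tau>"
      unfolding X2_def \<tau>_def by (simp add: sum.distrib sum_distrib_left[symmetric] orth)
    finally have lhs: "(\<Sum>z\<in>UNIV. W ?h z * (\<zeta> z * W i z)) = G * X2 + \<omega> * \<tau>" .
    have "(\<Sum>z\<in>UNIV. W ?h z * (\<zeta> z * W i z)) = (\<Sum>z\<in>UNIV.
        m * \<theta> i * (W ?h z * (W 1 z ^ 2 * W i z)) + (m - 1) * (W ?h z * (W 1 z * L1 i z)) + m * (W ?h z * L2 i z)
        - g * \<theta> i * (W ?h z * W 1 z * W i z) - g * (W ?h z * L1 i z) - \<rho> * \<theta> i * (W ?h z * W i z))"
      by (rule sum.cong) (simp_all add: expand[OF ih(1)] algebra_simps)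
    also have "\<dots> = m * \<theta> i * X2 + (m - 1) * X3 + m * (\<theta> ?h * X2) - g * \<theta> i * \<tau> - g * (\<theta> ?h * \<tau>)"
      unfolding sum.distrib sum_subtractf sum_distrib_left[symmetric] orth L1 L2
        X2_def[symmetric] X3_def[symmetric] \<tau>_def[symmetric] by simp
    finally have "\<tau> * (m * (?q + ?r) * (\<theta> i + \<theta> ?h)
      + (m - 1) * (?q * \<theta> i + ?r * \<theta> ?h) - g * (\<theta> i + \<theta> ?h)) = \<tau> * (G * (?q + ?r) + \<omega>)"
      unfolding lhs X2 X3 by (simp add: algebra_simps)
    then show ?thesis using \<tau> by simp
  qed
  show ?thesis
    by (rule that[OF m th, of g]) (use rel in \<open>simp_all add: G_def \<omega>_def\<close>)
qed

text \<open>With \<open>\<kappa> 1 1 1 = 0\<close>, the relations for \<open>i = 1\<close> and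
  \<open>i = 2\<close> are two linear equations in \<open>g\<close>, \<open>\<kappa> 1 2 2\<close>
  and \<open>\<kappa> 1 3 3\<close>.\<close>

lemma dual_a_2_3_iff:
  assumes "T 1 1 1 = 0"
  shows "T 1 2 2 = 0 \<longleftrightarrow> T 1 3 3 = 0"
proof -
  obtain m g where m: "m \<noteq> 0"
    and th: "\<theta> 1 - \<theta> 2 = m * (\<theta> 0 - \<theta> 3)" "\<theta> 2 - \<theta> 3 = m * (\<theta> 1 - \<theta> 4)"
    and rel: "\<forall>i<4. m * (\<kappa> 1 i i + \<kappa> 1 (Suc i) (Suc i)) * (\<theta> i + \<theta> (Suc i))
      + (m - 1) * (\<kappa> 1 i i * \<theta> i + \<kappa> 1 (Suc i) (Suc i) * \<theta> (Suc i)) - g * (\<theta> i + \<theta> (Suc i))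
      = (m * (\<theta> 0 + \<theta> 1 + \<theta> 2) - \<theta> 1) * (\<kappa> 1 i i + \<kappa> 1 (Suc i) (Suc i))
        + m * \<kappa> 1 1 1 * (\<theta> 1 - \<theta> 2) - g * (\<theta> 0 + \<theta> 1)"
    by (rule dual_a_relation)
  define q r where "q = \<kappa> 1 2 2" and "r = \<kappa> 1 3 3"
  have q1: "\<kappa> 1 1 1 = 0" using assms \<kappa>_eq_0_iff[OF diam_pos] by simp
  have 1: "m * q * (\<theta> 1 + \<theta> 2) + (m - 1) * (q * \<theta> 2) - g * (\<theta> 1 + \<theta> 2)
      = (m * (\<theta> 0 + \<theta> 1 + \<theta> 2) - \<theta> 1) * q - g * (\<theta> 0 + \<theta> 1)"
    using rel[rule_format, of 1] q1 by (simp add: q_def eval_nat_numeral)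
  have 2: "m * (q + r) * (\<theta> 2 + \<theta> 3) + (m - 1) * (q * \<theta> 2 + r * \<theta> 3) - g * (\<theta> 2 + \<theta> 3)
      = (m * (\<theta> 0 + \<theta> 1 + \<theta> 2) - \<theta> 1) * (q + r) - g * (\<theta> 0 + \<theta> 1)"
    using rel[rule_format, of 2] q1 by (simp add: q_def r_def eval_nat_numeral)
  have g_eq: "m * q * (\<theta> 2 - \<theta> 3) = g * (\<theta> 2 - \<theta> 0)"
    using 1 th by algebra
  have r_eq: "m * (q * (\<theta> 2 - \<theta> 1) + r * (\<theta> 3 - \<theta> 4)) = g * (\<theta> 2 + \<theta> 3 - \<theta> 0 - \<theta> 1)"
    using 2 th by algebra
  note neq = \<theta>_neq[of 2 0] \<theta>_neq[of 3 0] \<theta>_neq[of 3 1] \<theta>_neq[of 3 4]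
  have "q = 0 \<longleftrightarrow> r = 0"
  proof
    assume "q = 0"
    then have "g = 0" using g_eq neq by simp
    then show "r = 0" using r_eq \<open>q = 0\<close> m neq by simp
  next
    assume "r = 0"
    \<comment> \<open>Elimination of \<open>g\<close> leaves \<open>q\<close> with a product of
      differences of distinct eigenvalues.\<close>
    then have "m * q * ((\<theta> 3 - \<theta> 0) * (\<theta> 3 - \<theta> 1)) = 0"
      using g_eq r_eq by algebra
    then show "q = 0" using m neq by simp
  qed
  then show ?thesis unfolding q_def r_def using diam4 by (simp add: \<kappa>_eq_0_iff)
qed

end

section \<open>The structure (0,4,2,3,1)\<close>

text \<open>For the eigenvalue \<open>p + h\<close>, rows 0 and 1 of the eigenvector equation give
  \<open>x1\<close> and \<open>x2\<close>, and Leonard's recurrence, with \<open>h / p\<close> as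
  inverse constant, gives \<open>x3\<close> and \<open>x4\<close>. Rows 2 and 3 then constrain the
  intersection numbers. Both signs of \<open>h\<close> occur, one for each structure.\<close>

lemma eigen_column:
  fixes p h k :: real
  assumes nz: "p \<noteq> 0" "h \<noteq> 0" "h \<noteq> p" "h \<noteq> - p" "h \<noteq> 2 * p" "1 + p \<noteq> 0" "1 + p + h \<noteq> 0" "1 + p - h \<noteq> 0"
    and k: "k = (h\<^sup>2 - p\<^sup>2) / p" and a1: "a1 = h\<^sup>2 / (p * (1 + p))" and b1: "b1 = k - 1 - a1"
    and r0: "k * x1 = p + h" and r1: "1 + a1 * x1 + b1 * x2 = (p + h) * x1"
    and r2: "c2 * (x1 - x2) + b2 * (x3 - x2) = (p + h - k) * x2"
    and r3: "c3 * (x2 - x3) + b3 * (x4 - x3) = (p + h - k) * x3"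
    and s: "1 - x3 = h / p * (x1 - x2)" "x1 - x4 = h / p * (x2 - x3)"
  shows "x1 = p / (h - p)" and "x2 = (h - p - p\<^sup>2) / ((h - p) * (1 + p - h))"
    and "b2 * h - c2 * (p * (1 + p)) = - (h + p) * (h - p - p\<^sup>2)"
    and "c3 * h * p = (h\<^sup>2 - p * h - p\<^sup>2 - p ^ 3) * (b3 + h + p)"
proof -
  have d: "h - p \<noteq> 0" "h + p \<noteq> 0" "h - 2 * p \<noteq> 0" using nz by auto
  have k': "k = (h - p) * (h + p) / p" unfolding k by (simp add: power2_eq_square algebra_simps)
  have "(h + p) * ((h - p) * x1) = (h + p) * p"
    using r0 nz(1) unfolding k' by (simp add: field_simps)
  then have "(h - p) * x1 = p" using d by simp
  then show x1: "x1 = p / (h - p)" using d by (simp add: field_simps)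
  have b1': "b1 = - (1 + p + h) * (1 + p - h) / (1 + p)"
    unfolding b1 a1 k using nz by (simp add: divide_simps) algebra
  have b1nz: "b1 \<noteq> 0" unfolding b1' using nz(6-8) by simp
  \<comment> \<open>\<open>frac1\<close> to \<open>frac4\<close> bring the cosines over common
    denominators, so that only polynomial identities for the numerators remain.\<close>
  have frac1: "p / g * (p + h - h\<^sup>2 / (p * q)) - 1 = (p * (p + h) * q - h\<^sup>2 - g * q) / (g * q)"
    if "g \<noteq> 0" "q \<noteq> 0" for g q
    using that nz(1) by (simp add: field_simps)
  have frac2: "- (r * Q) / (g * q) = - r * v / q * (Q / (g * v))" if "v \<noteq> 0" for r Q g q v :: real
    using that by simp
  have frac3: "1 - h / p * (a / D) = (p * D - h * a) / (p * D)" if "D \<noteq> 0" for a D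
    using that nz(1) by (simp add: field_simps)
  have frac4: "Q / D - W / (p * D) = (p * Q - W) / (p * D)" if "p \<noteq> 0" for Q D W
    using that by (simp add: diff_divide_distrib)
  have "b1 * x2 = x1 * (p + h - a1) - 1" using r1 by (simp add: algebra_simps)
  also have "\<dots> = (p * (p + h) * (1 + p) - h\<^sup>2 - (h - p) * (1 + p)) / ((h - p) * (1 + p))"
    unfolding x1 a1 by (rule frac1) (use d nz in auto)
  also have "p * (p + h) * (1 + p) - h\<^sup>2 - (h - p) * (1 + p) = - ((1 + p + h) * (h - p - p\<^sup>2))"
    by algebra
  also have "\<dots> / ((h - p) * (1 + p)) = b1 * ((h - p - p\<^sup>2) / ((h - p) * (1 + p - h)))"
    unfolding b1' by (rule frac2) (rule nz)
  finally show x2: "x2 = (h - p - p\<^sup>2) / ((h - p) * (1 + p - h))"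
    by (rule iffD1[OF mult_left_cancel[OF b1nz]])
  let ?D = "(h - p) * (1 + p - h)" and ?W = "h\<^sup>2 - p * h - p\<^sup>2 - p ^ 3"
  have D: "?D \<noteq> 0" using d nz by simp
  have x1D: "x1 = p * (1 + p - h) / ?D" unfolding x1 using nz(8) by simp
  have "x1 - x2 = (p * (1 + p - h) - (h - p - p\<^sup>2)) / ?D"
    unfolding x1D x2 by (rule diff_divide_distrib[symmetric])
  also have "p * (1 + p - h) - (h - p - p\<^sup>2) = - (h - 2 * p) * (1 + p)" by algebra
  finally have x12: "x1 - x2 = - (h - 2 * p) * (1 + p) / ?D" .
  have "x3 = 1 - h / p * (x1 - x2)" using s(1) by simp
  also have "\<dots> = (p * ?D - h * (- (h - 2 * p) * (1 + p))) / (p * ?D)"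
    unfolding x12 by (rule frac3) (use D nz in auto)
  also have "p * ?D - h * (- (h - 2 * p) * (1 + p)) = ?W" by algebra
  finally have x3: "x3 = ?W / (p * ?D)" .
  have "x2 - x3 = (p * (h - p - p\<^sup>2) - ?W) / (p * ?D)"
    unfolding x2 x3 by (rule frac4) (rule nz)
  also have "p * (h - p - p\<^sup>2) - ?W = - h * (h - 2 * p)" by algebra
  finally have x23: "x2 - x3 = - h * (h - 2 * p) / (p * ?D)" .
  have common_denominator: "a / D - h / p * (- h * t / (p * D)) - W / (p * D)
      = (p\<^sup>2 * a + h\<^sup>2 * t - p * W) / (p * (p * D))" if "D \<noteq> 0" for a t D W
    using that nz(1) by (simp add: field_simps power2_eq_square)
  have x34: "x4 - x3 = ?W * (h - 2 * p) / (p * (p * ?D))"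
  proof -
    have "x4 - x3 = x1 - h / p * (x2 - x3) - x3" using s(2) by simp
    also have "\<dots> = x1 - h / p * (- h * (h - 2 * p) / (p * ?D)) - ?W / (p * ?D)"
      by (simp only: x23, simp only: x3)
    also note x1D
    also have "p * (1 + p - h) / ?D - h / p * (- h * (h - 2 * p) / (p * ?D)) - ?W / (p * ?D)
        = (p\<^sup>2 * (p * (1 + p - h)) + h\<^sup>2 * (h - 2 * p) - p * ?W) / (p * (p * ?D))"
      by (rule common_denominator[OF D])
    also have "p\<^sup>2 * (p * (1 + p - h)) + h\<^sup>2 * (h - 2 * p) - p * ?W = ?W * (h - 2 * p)" by algebra
    finally show ?thesis .
  qed
  have kk: "p + h - k = - (h - 2 * p) * (h + p) / p"
    unfolding k using nz by (simp add: field_simps power2_eq_square)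
  have "x3 - x2 = - (x2 - x3)" by simp
  also have "\<dots> = h * (h - 2 * p) / (p * ?D)" unfolding x23 by simp
  finally have x32: "x3 - x2 = h * (h - 2 * p) / (p * ?D)" .
  define t D W Q where "t = h - 2 * p" and "D = ?D" and "W = ?W" and "Q = h - p - p\<^sup>2"
  note abbr = t_def[symmetric] D_def[symmetric] W_def[symmetric] Q_def[symmetric]
  note x2 = x2[unfolded abbr] and x12 = x12[unfolded abbr] and x3 = x3[unfolded abbr] and x23 = x23[unfolded abbr]
    and x32 = x32[unfolded abbr] and x34 = x34[unfolded abbr] and kk = kk[unfolded abbr]
  have t: "t \<noteq> 0" "D \<noteq> 0" unfolding t_def D_def using D d by simp_all
  \<comment> \<open>Once denominators are cleared, both sides of row 2, and below of row 3, contain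
    the nonzero factor \<open>t = h - 2 * p\<close>.\<close>
  have "p * D * (c2 * (x1 - x2) + b2 * (x3 - x2)) = t * (b2 * h - c2 * (p * (1 + p)))"
    unfolding x12 x32 using nz t by (simp add: field_simps)
  moreover have "p * D * ((p + h - k) * x2) = t * (- (h + p) * Q)"
    unfolding kk x2 using nz t by (simp add: field_simps)
  ultimately have "t * (b2 * h - c2 * (p * (1 + p))) = t * (- (h + p) * Q)" using r2 by metis
  then show "b2 * h - c2 * (p * (1 + p)) = - (h + p) * (h - p - p\<^sup>2)" using t unfolding Q_def by simp
  have "p * p * D * (c3 * (x2 - x3) + b3 * (x4 - x3)) = t * (b3 * W - c3 * h * p)"
    unfolding x23 x34 using nz t by (simp add: field_simps)
  moreover have "p * p * D * ((p + h - k) * x3) = t * (- (h + p) * W)"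
    unfolding kk x3 using nz t by (simp add: field_simps)
  ultimately have "t * (b3 * W - c3 * h * p) = t * (- (h + p) * W)" using r3 by metis
  then have "b3 * W - c3 * h * p = - (h + p) * W" using t by simp
  then show "c3 * h * p = ?W * (b3 + h + p)" unfolding W_def[symmetric] by (simp add: algebra_simps)
qed

text \<open>With \<open>M = N - 1\<close> one has \<open>c = M * P + N\<close>. For
  \<open>M = 0\<close> the equations force \<open>c3 + P * P = 1\<close>. Otherwise
  \<open>c * b3 = P * P\<close> gives \<open>P = b3 * M + l\<close> with \<open>l > 0\<close> and
  \<open>l * P = b3 * N\<close>, whence \<open>l * M < M + 1\<close>, so \<open>l = 1\<close>,
  \<open>b3 = 1\<close> and \<open>P = N\<close>.\<close>

lemma no_feasible_array:
  fixes N P a c b3 c3 :: nat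
  assumes "N * (1 + P) = a" "c + P = a" "c * b3 = P * P" "c3 + b3 + P = (1 + P) * c"
    and "c3 > 0" "P > 0" "N \<noteq> P"
  shows False
proof -
  have "N > 0" using assms by (cases N) auto
  then obtain M where N: "N = Suc M" by (cases N) auto
  have c: "c = M * P + N" using assms(1,2) N by (simp add: algebra_simps)
  show False
  proof (cases M)
    case 0
    then have "c = 1" using c N by simp
    then have "c3 + P * P + P = 1 + P" using assms(3,4) by simp
    then show False using assms(5,6) by (cases P) auto
  next
    case (Suc M')
    have eq: "b3 * M * P + b3 * N = P * P" using assms(3) unfolding c by (simp add: algebra_simps)
    have b3: "b3 > 0" using assms(3,6) by (cases b3) auto
    then have "b3 * M * P < P * P" using eq N by (metis less_add_same_cancel1 nat_0_less_mult_iff zero_less_Suc)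
    then have "b3 * M < P" by simp
    then obtain l where l: "P = b3 * M + l" "l > 0" by (metis less_imp_add_positive)
    have "l * P = b3 * N" using eq unfolding l(1) by (simp add: algebra_simps)
    then have "l * l + l * b3 * M = b3 * N" unfolding l(1) by (simp add: algebra_simps)
    moreover have "l * l > 0" using l by simp
    moreover have "l * b3 * M = b3 * (l * M)" by simp
    ultimately have "b3 * (l * M) < b3 * N" by linarith
    then have "l * M < N" by simp
    then have "l * M < Suc M" using N by simp
    then have "l = 1" using l(2) Suc by (cases l; cases "l - 1") auto
    then have "1 + b3 * M = b3 * Suc M" using \<open>l * l + l * b3 * M = b3 * N\<close> N by simp
    then have "b3 = 1" by simp
    then show False using l \<open>l = 1\<close> N assms(7) by simp
  qed
qed


section \<open>The Schur product of \<open>E 1\<close> and \<open>E 4\<close>\<close>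

context q_poly4
begin

text \<open>A zero of \<open>u 1\<close> or \<open>u 4\<close> at distance 2 spreads: the product
  with index 3 makes \<open>u 3 2\<close> vanish, the product with \<open>u 2\<close> makes
  \<open>u 2 2\<close> vanish, and the square then forces \<open>u 0 2 = 0\<close>.\<close>

lemma u_2_neq_0:
  assumes "T 4 4 1 = 0" "T 1 2 2 \<noteq> 0"
  shows "u 1 2 \<noteq> 0" "u 4 2 \<noteq> 0"
proof -
  have d: "i \<le> 4 \<Longrightarrow> i \<le> diam" for i using diam4 by simp
  have z: "\<kappa> 1 2 0 = 0" "\<kappa> 1 2 4 = 0" "\<kappa> 4 2 0 = 0" "\<kappa> 4 2 1 = 0" "\<kappa> 4 4 1 = 0" "\<kappa> 1 1 3 = 0" "\<kappa> 1 1 4 = 0"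
      "\<kappa> 1 4 0 = 0" "\<kappa> 1 4 1 = 0" "\<kappa> 1 4 2 = 0" "\<kappa> 1 4 4 = 0"
    using T_far[of 0 1 2] T_far[of 1 2 4] T_far[of 0 2 4] T_far[of 1 2 4] T_far[of 1 1 3] T_far[of 1 1 4]
      T_far[of 0 1 4] assms(1) d
    unfolding \<kappa>_def T_swap23[of 1 2 0] T_swap12[of 1 0 2] T_swap12[of 4 2 0] T_swap23[of 2 4 0] T_swap12[of 2 0 4]
      T_swap12[of 4 2 1] T_swap23[of 2 4 1] T_swap12[of 2 1 4] T_swap23[of 1 4 0] T_swap12[of 1 0 4]
      T_swap23[of 1 4 1] T_swap23[of 1 4 2] T_swap12[of 1 4 4] T_swap23[of 4 1 4]
    by simp_all
  have nz: "\<kappa> 1 2 2 \<noteq> 0" "\<kappa> 4 2 2 \<noteq> 0" "\<kappa> 1 4 3 \<noteq> 0" "\<kappa> 1 1 0 \<noteq> 0" "\<kappa> 4 4 0 \<noteq> 0"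
    using T_sum[of 2 2] T_sum[of 1 3] T_sum[of 0 1] T_sum[of 0 4] assms(2) d
      T_swap23[of 1 4 3] T_swap12[of 4 2 2] T_swap23[of 2 4 2] T_swap23[of 1 1 0] T_swap12[of 1 0 1]
      T_swap23[of 4 4 0] T_swap12[of 4 0 4]
    by (simp_all add: \<kappa>_eq_0_iff)
  have p14: "u 1 2 * u 4 2 = \<kappa> 1 4 3 * u 3 2"
    using schur_u[OF d d d, of 1 4 2] z unfolding sum_diam by simp
  have p12: "u 1 2 * u 2 2 = \<kappa> 1 2 1 * u 1 2 + \<kappa> 1 2 2 * u 2 2 + \<kappa> 1 2 3 * u 3 2"
    using schur_u[OF d d d, of 1 2 2] z unfolding sum_diam by simp
  have p42: "u 4 2 * u 2 2 = \<kappa> 4 2 2 * u 2 2 + \<kappa> 4 2 3 * u 3 2 + \<kappa> 4 2 4 * u 4 2"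
    using schur_u[OF d d d, of 4 2 2] z unfolding sum_diam by simp
  have p11: "u 1 2 * u 1 2 = \<kappa> 1 1 0 * u 0 2 + \<kappa> 1 1 1 * u 1 2 + \<kappa> 1 1 2 * u 2 2"
    using schur_u[OF d d d, of 1 1 2] z unfolding sum_diam by simp
  have p44: "u 4 2 * u 4 2 = \<kappa> 4 4 0 * u 0 2 + \<kappa> 4 4 2 * u 2 2 + \<kappa> 4 4 3 * u 3 2 + \<kappa> 4 4 4 * u 4 2"
    using schur_u[OF d d d, of 4 4 2] z unfolding sum_diam by simp
  have u0: "u 0 2 \<noteq> 0" by (simp add: u_0)
  show "u 1 2 \<noteq> 0"
  proof
    assume 0: "u 1 2 = 0"
    then have "u 3 2 = 0" using p14 nz by simp
    then have "u 2 2 = 0" using p12 0 nz by simp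
    then show False using p11 0 nz u0 by simp
  qed
  show "u 4 2 \<noteq> 0"
  proof
    assume 0: "u 4 2 = 0"
    then have "u 3 2 = 0" using p14 nz by simp
    moreover then have "u 2 2 = 0" using p42 0 nz by simp
    ultimately show False using p44 0 nz u0 by simp
  qed
qed

text \<open>The triple sums vanish for every index except 3, so the product of a column of
  \<open>E 4\<close> and a column of \<open>E 1\<close> lies in the eigenspace of
  \<open>\<theta> 3\<close>. The two base points may differ, which gives access to
  triangles.\<close>

lemma product_eigenvector:
  assumes "T 4 4 1 = 0"
  shows "(\<Sum>z\<in>UNIV. A y z * (e 4 z x * e 1 z w)) = \<theta> 3 * (e 4 y x * e 1 y w)"
proof -
  have d: "i \<le> 4 \<Longrightarrow> i \<le> diam" for i using diam4 by simp
  let ?g = "\<lambda>i z. \<Sum>v\<in>UNIV. e i z v * (e 4 v x * e 1 v w)"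
  have far: "T 0 4 1 = 0" "T 1 4 1 = 0" "T 2 4 1 = 0"
    using T_far[of 0 1 4] T_far[of 1 1 4] T_far[of 2 1 4] d
    unfolding T_swap23[of 0 4 1] T_swap23[of 1 4 1] T_swap23[of 2 4 1] by simp_all
  have T0: "T i 4 1 = 0" if i: "i \<le> 4" "i \<noteq> 3" for i
  proof -
    consider "i = 0" | "i = 1" | "i = 2" | "i = 4" using i by linarith
    then show ?thesis using far assms by cases simp_all
  qed
  have g0: "?g i z = 0" if "i \<le> 4" "i \<noteq> 3" for i z
    using krein_triple_zero[OF d d d T0[OF that], of z x w] that e_commute[OF d, of i] by (simp add: mult.assoc)
  have g3: "e 4 z x * e 1 z w = ?g 3 z" for z
  proof -
    have "e 4 z x * e 1 z w = (\<Sum>v\<in>UNIV. (if z = v then 1 else 0) * (e 4 v x * e 1 v w))"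
      by (simp add: if_distrib[of "\<lambda>t. t * _"] cong: if_cong)
    also have "\<dots> = (\<Sum>v\<in>UNIV. \<Sum>i\<le>diam. e i z v * (e 4 v x * e 1 v w))"
      unfolding e_sum[symmetric] sum_distrib_right ..
    also have "\<dots> = (\<Sum>i\<le>diam. ?g i z)" by (rule sum.swap)
    also have "\<dots> = ?g 3 z" unfolding sum_diam using g0 by simp
    finally show ?thesis .
  qed
  have "(\<Sum>z\<in>UNIV. A y z * (e 4 z x * e 1 z w)) = (\<Sum>z\<in>UNIV. \<Sum>v\<in>UNIV. A y z * e 3 z v * (e 4 v x * e 1 v w))"
    by (rule sum.cong[OF refl], subst g3) (simp only: sum_distrib_left mult.assoc)
  also have "\<dots> = (\<Sum>v\<in>UNIV. (\<Sum>z\<in>UNIV. A y z * e 3 z v) * (e 4 v x * e 1 v w))"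
    unfolding sum_distrib_right by (rule sum.swap)
  also have "\<dots> = \<theta> 3 * ?g 3 y"
    unfolding A_eigen[OF d[of 3], simplified] by (simp add: sum_distrib_left mult.assoc)
  finally show ?thesis by (simp only: g3[of y, symmetric])
qed

end

section \<open>Counting around a triangle\<close>

context q_poly4
begin

text \<open>The eigenvector equation for the product is read at the vertex \<open>z\<close> of the
  triangle. Among the common neighbours of \<open>x\<close> and \<open>z\<close> there are
  \<open>w\<close>, \<open>N\<close> neighbours of \<open>w\<close>, and the rest at distance 2 from
  \<open>w\<close>.\<close>

lemma local_count:
  assumes T: "T 4 4 1 = 0" and xz: "adj x z" and xw: "adj x w" and zw: "adj z w"
    and N: "N = card {v. adj z v \<and> adj x v \<and> adj w v}"
  shows "(u 4 0 - u 4 2) * u 1 1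
    + (u 4 1 - u 4 2) * (u 1 0 + real N * u 1 1 + (real (nbrs 1 1) - 1 - real N) * u 1 2)
    = (\<theta> 3 * u 4 1 - \<theta> 1 * u 4 2) * u 1 1"
proof -
  have d: "1 \<le> diam" "4 \<le> diam" using diam4 by auto
  have g1: "dist_G a b = 1" if "adj a b" for a b using that gdist_eq_1_iff by blast
  have two: "dist_G v b = 2" if "adj z v" "v \<noteq> b" "\<not> adj v b" "adj z b" for v b
  proof -
    have "dist_G v b \<le> 2" using gdist_adj_bounds(2)[OF that(1), of b] g1[OF that(4)] by simp
    moreover have "dist_G v b \<noteq> 0" "dist_G v b \<noteq> 1" using that gdist_eq_1_iff by auto
    ultimately show ?thesis by linarith
  qed
  define S where "S = {v. adj z v \<and> adj x v}"
  have card_S: "card S = nbrs 1 1"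
  proof -
    have "{v. adj z v \<and> dist_G v x = 1} = S"
      unfolding S_def gdist_eq_1_iff using adj_sym by blast
    then show ?thesis using nbrs[OF g1[OF adj_sym[OF xz]], of 1] by simp
  qed
  have wS: "w \<in> S" unfolding S_def using zw xw by simp
  let ?S1 = "{v. adj z v \<and> adj x v \<and> adj w v}"
  have S1: "?S1 \<subseteq> S - {w}" unfolding S_def using adj_irrefl by auto
  have "(\<Sum>v\<in>S. u 1 (dist_G v w)) = u 1 0 + (\<Sum>v\<in>S - {w}. u 1 (dist_G v w))"
    using sum.remove[OF _ wS, of "\<lambda>v. u 1 (dist_G v w)"] by simp
  also have "(\<Sum>v\<in>S - {w}. u 1 (dist_G v w))
      = (\<Sum>v\<in>S - {w} - ?S1. u 1 (dist_G v w)) + (\<Sum>v\<in>?S1. u 1 (dist_G v w))"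
    by (rule sum.subset_diff[OF S1]) simp
  also have "(\<Sum>v\<in>?S1. u 1 (dist_G v w)) = (\<Sum>v\<in>?S1. u 1 1)"
    by (rule sum.cong) (use g1 adj_sym in auto)
  also have "(\<Sum>v\<in>S - {w} - ?S1. u 1 (dist_G v w)) = (\<Sum>v\<in>S - {w} - ?S1. u 1 2)"
  proof (rule sum.cong[OF refl])
    fix v assume "v \<in> S - {w} - ?S1"
    then have "dist_G v w = 2" unfolding S_def using zw adj_sym by (intro two) auto
    then show "u 1 (dist_G v w) = u 1 2" by simp
  qed
  also have "\<dots> = (real (nbrs 1 1) - 1 - real N) * u 1 2"
  proof -
    have "card (S - {w} - ?S1) = card S - 1 - N"
      unfolding N using card_Diff_subset[OF _ S1] wS by simp
    moreover have "card ?S1 \<le> card (S - {w})" by (rule card_mono[OF _ S1]) simp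
    moreover have "card S \<ge> 1" using wS card_gt_0_iff[of S] by fastforce
    ultimately show ?thesis using wS unfolding N by (simp add: card_S of_nat_diff)
  qed
  finally have local: "(\<Sum>v\<in>S. u 1 (dist_G v w))
      = u 1 0 + real N * u 1 1 + (real (nbrs 1 1) - 1 - real N) * u 1 2"
    unfolding N by simp
  have xS: "x \<notin> S" unfolding S_def using adj_irrefl by simp
  \<comment> \<open>Subtracting \<open>u 4 2\<close> times the equation for \<open>E 1\<close>
    removes the neighbours of \<open>z\<close> at distance 2 from \<open>x\<close>, whose distances
    to \<open>w\<close> are unknown.\<close>
  have "(\<Sum>v\<in>UNIV. A z v * ((u 4 (dist_G v x) - u 4 2) * u 1 (dist_G v w)))
      = (\<Sum>v\<in>insert x S. (u 4 (dist_G v x) - u 4 2) * u 1 (dist_G v w))"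
  proof (rule sum.mono_neutral_cong_right)
    show "\<forall>v\<in>UNIV - insert x S. A z v * ((u 4 (dist_G v x) - u 4 2) * u 1 (dist_G v w)) = 0"
    proof
      fix v assume v: "v \<in> UNIV - insert x S"
      show "A z v * ((u 4 (dist_G v x) - u 4 2) * u 1 (dist_G v w)) = 0"
      proof (cases "adj z v")
        case True
        then have "dist_G v x = 2" using v adj_sym xz unfolding S_def by (intro two) auto
        then show ?thesis by simp
      qed (simp add: A_def)
    qed
  qed (auto simp: A_def S_def adj_sym[OF xz])
  also have "\<dots> = (u 4 0 - u 4 2) * u 1 1 + (\<Sum>v\<in>S. (u 4 (dist_G v x) - u 4 2) * u 1 (dist_G v w))"
    using xS g1[OF xw] by simp
  also have "(\<Sum>v\<in>S. (u 4 (dist_G v x) - u 4 2) * u 1 (dist_G v w))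
      = (\<Sum>v\<in>S. (u 4 1 - u 4 2) * u 1 (dist_G v w))"
    by (rule sum.cong[OF refl]) (use g1 adj_sym in \<open>auto simp: S_def\<close>)
  also have "\<dots> = (u 4 1 - u 4 2) * (\<Sum>v\<in>S. u 1 (dist_G v w))"
    by (rule sum_distrib_left[symmetric])
  finally have lhs: "(\<Sum>v\<in>UNIV. A z v * ((u 4 (dist_G v x) - u 4 2) * u 1 (dist_G v w)))
      = (u 4 0 - u 4 2) * u 1 1 + (u 4 1 - u 4 2) * (\<Sum>v\<in>S. u 1 (dist_G v w))" .
  have "(\<Sum>v\<in>UNIV. A z v * ((u 4 (dist_G v x) - u 4 2) * u 1 (dist_G v w)))
      = (\<Sum>v\<in>UNIV. A z v * (e 4 v x * e 1 v w) - u 4 2 * (A z v * e 1 v w))"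
    by (rule sum.cong[OF refl]) (simp only: e_u[OF d(1)] e_u[OF d(2)], simp add: algebra_simps)
  also have "\<dots> = \<theta> 3 * (e 4 z x * e 1 z w) - u 4 2 * (\<theta> 1 * e 1 z w)"
    unfolding sum_subtractf sum_distrib_left[symmetric] product_eigenvector[OF T] A_eigen[OF d(1)] ..
  also have "\<dots> = (\<theta> 3 * u 4 1 - \<theta> 1 * u 4 2) * u 1 1"
    unfolding e_u[OF d(1)] e_u[OF d(2)] g1[OF zw] g1[OF adj_sym[OF xz]] by (simp add: algebra_simps)
  finally show ?thesis unfolding lhs local .
qed

lemma nbrs_far:
  "nbrs 0 0 = 0" "nbrs 0 2 = 0" "nbrs 0 3 = 0" "nbrs 0 4 = 0"
  "nbrs 1 0 = 1" "nbrs 1 3 = 0" "nbrs 1 4 = 0"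
  "nbrs 2 0 = 0" "nbrs 2 4 = 0" "nbrs 3 0 = 0" "nbrs 3 1 = 0"
proof -
  fix x :: 'n
  have "{z. adj x z \<and> dist_G z x = 0} = {}" using adj_irrefl by auto
  then show "nbrs 0 0 = 0" using nbrs[of x x 0 0] by (metis card.empty gdist_refl)
  obtain y where xy: "dist_G x y = 1" using ex_dist[of 1] diam_pos by blast
  then have "adj x y" using gdist_eq_1_iff by simp
  then have "{z. adj x z \<and> dist_G z y = 0} = {y}" by auto
  then have "nbrs 1 0 = card {y}" using nbrs[OF xy, of 0] by metis
  then show "nbrs 1 0 = 1" by simp
qed (simp_all add: nbrs_eq_0 diam4)

text \<open>Rows 0 to 3 of the eigenvector equation for the intersection matrix, normalised to value
  1 at distance 0.\<close>

lemma column: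
  assumes "\<And>h. h \<le> 4 \<Longrightarrow> (\<Sum>l\<le>diam. real (nbrs h l) * f l) = t * f h" and "f 0 \<noteq> 0"
  defines "g \<equiv> \<lambda>j. f j / f 0"
  shows "real (nbrs 0 1) * g 1 = t"
    and "1 + real (nbrs 1 1) * g 1 + real (nbrs 1 2) * g 2 = t * g 1"
    and "real (nbrs 2 1) * g 1 + real (nbrs 2 2) * g 2 + real (nbrs 2 3) * g 3 = t * g 2"
    and "real (nbrs 3 2) * g 2 + real (nbrs 3 3) * g 3 + real (nbrs 3 4) * g 4 = t * g 3"
proof -
  have f: "f j = f 0 * g j" for j unfolding g_def using assms(2) by simp
  have g0: "g 0 = 1" unfolding g_def using assms(2) by simp
  have "(\<Sum>l\<le>diam. real (nbrs h l) * g l) = t * g h" if "h \<le> 4" for h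
  proof -
    have "f 0 * (\<Sum>l\<le>diam. real (nbrs h l) * g l) = f 0 * (t * g h)"
      using assms(1)[OF that] f[of h] unfolding sum_distrib_left
      by (subst (asm) f) (simp add: mult_ac)
    then show ?thesis using assms(2) by simp
  qed
  note row = this[unfolded sum_diam]
  show "real (nbrs 0 1) * g 1 = t" using row[of 0] by (simp add: nbrs_far[unfolded One_nat_def] g0)
  show "1 + real (nbrs 1 1) * g 1 + real (nbrs 1 2) * g 2 = t * g 1"
    using row[of 1] by (simp add: nbrs_far[unfolded One_nat_def] g0)
  show "real (nbrs 2 1) * g 1 + real (nbrs 2 2) * g 2 + real (nbrs 2 3) * g 3 = t * g 2"
    using row[of 2] by (simp add: nbrs_far[unfolded One_nat_def] g0)
  show "real (nbrs 3 2) * g 2 + real (nbrs 3 3) * g 3 + real (nbrs 3 4) * g 4 = t * g 3"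
    using row[of 3] by (simp add: nbrs_far[unfolded One_nat_def] g0)
qed

end

text \<open>Here \<open>t1\<close> to \<open>t4\<close> are the eigenvalues other than
  \<open>k\<close>, \<open>x\<close> and \<open>y\<close> are the cosines of \<open>E 1\<close> and
  \<open>E 4\<close>, and the products of these cosines belong to \<open>t3\<close>. All is
  expressed through \<open>p = t2\<close> and \<open>h = t1 - t2\<close>; exchange of the structures
  changes the sign of \<open>h\<close>.\<close>

lemma feasible_parameters:
  fixes k :: real
  assumes sums: "1 + a1 + b1 = k" "c2 + a2 + b2 = k" "c3 + a3 + b3 = k"
    and pos: "b1 > 0" "a1 \<ge> 0" "c2 \<ge> 0" "a2 \<ge> 0"
    and neq: "t1 \<noteq> k" "t4 \<noteq> k" "t1 \<noteq> t2" "t1 \<noteq> t4" "t3 \<noteq> k"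
    and m: "t1 - t2 = m * (k - t3)" "t2 - t3 = m * (t1 - t4)"
    and m': "t4 - t2 = m' * (k - t3)" "t2 - t3 = m' * (t4 - t1)"
    and x: "x1 - x2 = m * (1 - x3)" "x2 - x3 = m * (x1 - x4)"
    and y: "y1 - y2 = m' * (1 - y3)" "y2 - y3 = m' * (y1 - y4)"
    and x_col: "k * x1 = t1" "1 + a1 * x1 + b1 * x2 = t1 * x1"
      "c2 * x1 + a2 * x2 + b2 * x3 = t1 * x2" "c3 * x2 + a3 * x3 + b3 * x4 = t1 * x3"
    and y_col: "k * y1 = t4" "1 + a1 * y1 + b1 * y2 = t4 * y1"
      "c2 * y1 + a2 * y2 + b2 * y3 = t4 * y2" "c3 * y2 + a3 * y3 + b3 * y4 = t4 * y3"
    and xy_col: "k * (x1 * y1) = t3" "1 + a1 * (x1 * y1) + b1 * (x2 * y2) = t3 * (x1 * y1)"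
    and nz2: "x2 \<noteq> 0" "y2 \<noteq> 0"
    and local: "a1 > 0 \<Longrightarrow> (1 - y2) * x1 + (y1 - y2) * (1 + N * x1 + (a1 - 1 - N) * x2) = (t3 * y1 - t1 * y2) * x1"
  obtains p where "p > 0" "N * (1 + p) = a1" "c2 + p = a1" "c2 * b3 = p * p"
    "c3 + b3 + p = (1 + p) * c2" "N \<noteq> p"
proof -
  define p h where "p = t2" and "h = t1 - t2"
  have k1: "k > 1" using sums pos by linarith
  have h0: "h \<noteq> 0" unfolding h_def using neq by simp
  have "(m + m') * (t1 - t4) = 0" using m(2) m'(2) by (simp add: algebra_simps)
  then have mm: "m' = - m" using neq by (simp add: eq_neg_iff_add_eq_0 add.commute)
  have t1: "t1 = p + h" unfolding p_def h_def by simp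
  have t4: "t4 = p - h" using m(1) m'(1) unfolding mm p_def h_def by (simp add: algebra_simps)
  \<comment> \<open>Row 0 for \<open>x\<close>, for \<open>y\<close> and for their product.\<close>
  have prod: "(p + h) * (p - h) = k * t3"
    using x_col(1) y_col(1) xy_col(1) unfolding t1 t4 by algebra
  have hm: "h = m * (k - t3)" using m(1) unfolding h_def .
  have pm: "p - t3 = 2 * h * m" using m(2) unfolding t1 t4 p_def by (simp add: algebra_simps)
  \<comment> \<open>Elimination of \<open>m\<close> and \<open>h\<close> leaves a quadratic equation
    for \<open>t3\<close>; its other root would make \<open>t1\<close> or \<open>t4\<close> equal to
    \<open>k\<close>.\<close>
  have "(t3 + p) * (t3 + k - 2 * p) = 0" using prod hm pm by algebra
  moreover have "t3 + k - 2 * p \<noteq> 0"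
  proof
    assume "t3 + k - 2 * p = 0"
    then have "(h - (k - p)) * (h + (k - p)) = 0" using prod by algebra
    then show False using neq unfolding t1 t4 by auto
  qed
  ultimately have t3: "t3 = - p" by simp
  have hh: "h\<^sup>2 = p\<^sup>2 + k * p" using prod unfolding t3 by algebra
  have p0: "p \<noteq> 0" using hh h0 by auto
  have k_eq: "k = (h\<^sup>2 - p\<^sup>2) / p" using hh p0 by simp
  have h2p: "h \<noteq> 2 * p" "- h \<noteq> 2 * p" "k \<noteq> 3 * p"
  proof -
    have *: "k = 3 * p" if "h = 2 * p \<or> - h = 2 * p"
    proof -
      have "p * (k - 3 * p) = 0" using that hh by algebra
      then show ?thesis using p0 by simp
    qed
    show "h \<noteq> 2 * p" using * neq(1) unfolding t1 by auto
    show "- h \<noteq> 2 * p" using * neq(2) unfolding t4 by auto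
    show "k \<noteq> 3 * p"
    proof
      assume k3: "k = 3 * p"
      then have "(h - 2 * p) * (h + 2 * p) = 0" using hh by algebra
      then show False using neq(1,2) k3 unfolding t1 t4 by auto
    qed
  qed
  \<comment> \<open>Row 1 gives \<open>b1 * x2\<close>, \<open>b1 * y2\<close> and
    \<open>b1 * (x2 * y2)\<close>; the product of the first two is \<open>b1\<close> times the
    third, and the equation is scaled by the square of \<open>k\<close>.\<close>
  have "((p + h)\<^sup>2 - k - a1 * (p + h)) * ((p - h)\<^sup>2 - k - a1 * (p - h))
      = b1 * (k * p\<^sup>2 - k\<^sup>2 + a1 * k * p)"
    using x_col(1,2) y_col(1,2) xy_col unfolding t1 t4 t3 by algebra
  then have "k * ((k - 3 * p) * (a1 * (1 + p) - (k + p))) = 0" using hh sums(1) by algebra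
  then have a1p: "a1 * (1 + p) = k + p" using k1 h2p(3) by simp
  have p1: "1 + p \<noteq> 0" using a1p k1 by auto
  have a1h: "a1 * (p * (1 + p)) = h\<^sup>2" using a1p hh by algebra
  then have a1_eq: "a1 = h\<^sup>2 / (p * (1 + p))" using p0 p1 by (simp add: eq_divide_eq)
  have "b1 * (1 + p) = (k - 1) * (1 + p) - a1 * (1 + p)"
    unfolding sums(1)[symmetric] by (simp add: algebra_simps)
  also have "\<dots> = - ((1 + p)\<^sup>2 - h\<^sup>2)"
    unfolding a1p hh by (simp add: power2_eq_square algebra_simps)
  also have "\<dots> = - ((1 + p + h) * (1 + p - h))" by algebra
  finally have "b1 * (1 + p) = - ((1 + p + h) * (1 + p - h))" .
  moreover have "b1 * (1 + p) \<noteq> 0" using pos p1 by simp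
  ultimately have hp1: "1 + p + h \<noteq> 0" "1 + p - h \<noteq> 0" by auto
  have "(p + h) * (p - h) \<noteq> 0" using prod k1 p0 unfolding t3 by simp
  then have hp: "h \<noteq> p" "h \<noteq> - p" by auto
  have "h * (p - h * m) = 0" using pm unfolding t3 by simp
  then have hm1: "h * m = p" using h0 by simp
  have m0: "m \<noteq> 0" using hm1 p0 by auto
  have s: "h / p = 1 / m" using hm1 m0 p0 by (simp add: field_simps)
  have b1_eq: "b1 = k - 1 - a1" using sums by simp
  have X: "x1 = p / (h - p)" "x2 = (h - p - p\<^sup>2) / ((h - p) * (1 + p - h))"
    "b2 * h - c2 * (p * (1 + p)) = - (h + p) * (h - p - p\<^sup>2)"
    "c3 * h * p = (h\<^sup>2 - p * h - p\<^sup>2 - p ^ 3) * (b3 + h + p)"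
  proof -
    have 1: "c2 * (x1 - x2) + b2 * (x3 - x2) = (p + h - k) * x2"
      using x_col(3) sums(2) unfolding t1 by algebra
    have 2: "c3 * (x2 - x3) + b3 * (x4 - x3) = (p + h - k) * x3"
      using x_col(4) sums(3) unfolding t1 by algebra
    have 3: "1 - x3 = h / p * (x1 - x2)" "x1 - x4 = h / p * (x2 - x3)"
      unfolding s using x m0 by simp_all
    note * = eigen_column[OF p0 h0 hp h2p(1) p1 hp1 k_eq a1_eq b1_eq x_col(1,2)[unfolded t1] 1 2 3]
    show "x1 = p / (h - p)" "x2 = (h - p - p\<^sup>2) / ((h - p) * (1 + p - h))"
      "b2 * h - c2 * (p * (1 + p)) = - (h + p) * (h - p - p\<^sup>2)"
      "c3 * h * p = (h\<^sup>2 - p * h - p\<^sup>2 - p ^ 3) * (b3 + h + p)" by (rule *)+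
  qed
  have Y: "y1 = p / (- h - p)" "y2 = (- h - p - p\<^sup>2) / ((- h - p) * (1 + p - - h))"
    "b2 * - h - c2 * (p * (1 + p)) = - (- h + p) * (- h - p - p\<^sup>2)"
    "c3 * - h * p = ((- h)\<^sup>2 - p * - h - p\<^sup>2 - p ^ 3) * (b3 + - h + p)"
  proof -
    have 1: "c2 * (y1 - y2) + b2 * (y3 - y2) = (p + - h - k) * y2"
      using y_col(3) sums(2) unfolding t4 by algebra
    have 2: "c3 * (y2 - y3) + b3 * (y4 - y3) = (p + - h - k) * y3"
      using y_col(4) sums(3) unfolding t4 by algebra
    have 3: "1 - y3 = - h / p * (y1 - y2)" "y1 - y4 = - h / p * (y2 - y3)"
      using y m0 unfolding mm minus_divide_left[symmetric] s by simp_all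
    have nz: "- h \<noteq> 0" "- h \<noteq> p" "- h \<noteq> - p" "1 + p + - h \<noteq> 0" "1 + p - - h \<noteq> 0"
      using h0 hp hp1 by auto
    have eqs: "k = ((- h)\<^sup>2 - p\<^sup>2) / p" "a1 = (- h)\<^sup>2 / (p * (1 + p))"
      "k * y1 = p + - h" "1 + a1 * y1 + b1 * y2 = (p + - h) * y1"
      using k_eq a1_eq y_col(1,2) unfolding t4 by simp_all
    note * = eigen_column[OF p0 nz(1-3) h2p(2) p1 nz(4,5) eqs(1,2) b1_eq eqs(3,4) 1 2 3]
    show "y1 = p / (- h - p)" "y2 = (- h - p - p\<^sup>2) / ((- h - p) * (1 + p - - h))"
      "b2 * - h - c2 * (p * (1 + p)) = - (- h + p) * (- h - p - p\<^sup>2)"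
      "c3 * - h * p = ((- h)\<^sup>2 - p * - h - p\<^sup>2 - p ^ 3) * (b3 + - h + p)" by (rule *)+
  qed
  \<comment> \<open>\<open>X\<close> and \<open>Y\<close> differ by the sign of \<open>h\<close>, so
    their combinations separate the parts even and odd in \<open>h\<close>.\<close>
  have "h * (b2 - p\<^sup>2) = 0" using X(3) Y(3) by algebra
  then have b2: "b2 = p\<^sup>2" using h0 by simp
  have c2h: "c2 * (p * (1 + p)) = h\<^sup>2 - p\<^sup>2 - p ^ 3" using X(3) Y(3) by algebra
  then have "p * (1 + p) * (c2 + p - a1) = 0" using a1h by algebra
  then have c2: "c2 + p = a1" using p0 p1 by simp
  have b3: "c2 * b3 = p * p"
  proof -
    have "p * (1 + p) * ((b3 + p) * c2 - a1 * p) = 0" using X(4) Y(4) c2h a1h by algebra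
    then have "(b3 + p) * c2 = a1 * p" using p0 p1 by simp
    then show ?thesis using c2 by algebra
  qed
  have c3: "c3 + b3 + p = (1 + p) * c2"
  proof -
    have "h * p * (c3 + b3 + p - (1 + p) * c2) = 0" using X(4) Y(4) c2h by algebra
    then show ?thesis using p0 h0 by simp
  qed
  \<comment> \<open>A negative \<open>p\<close> would satisfy \<open>p + k < 0\<close>, so that
    \<open>b2\<close>, the square of \<open>p\<close>, would exceed \<open>k\<close>.\<close>
  have p_pos: "p > 0"
  proof (rule ccontr)
    assume "\<not> p > 0"
    then have neg: "p < 0" using p0 by simp
    have "p * (p + k) = h\<^sup>2" using hh by (simp add: power2_eq_square algebra_simps)
    then have "p * (p + k) > 0" using h0 by simp
    then have "p + k < 0" using neg by (simp add: zero_less_mult_iff)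
    then have "(- p) * (- p) > k * k" using k1 by (intro mult_strict_mono) auto
    moreover have "k * k > k" using k1 by simp
    moreover have "b2 \<le> k" using sums(2) pos by linarith
    ultimately show False unfolding b2 by (simp add: power2_eq_square)
  qed
  have a1_pos: "a1 > 0" unfolding a1_eq using p_pos h0 by simp
  have N: "N * (1 + p) = a1"
  proof -
    define D D' where "D = (h - p) * (1 + p - h)" and "D' = (- h - p) * (1 + p - - h)"
    have DD: "D \<noteq> 0" "D' \<noteq> 0" unfolding D_def D'_def using hp hp1 by auto
    have e: "x1 * D = p * (1 + p - h)" "y1 * D' = p * (1 + p + h)"
      "x2 * D = h - p - p\<^sup>2" "y2 * D' = - h - p - p\<^sup>2"
      unfolding D_def D'_def X(1,2) Y(1,2) using hp hp1 by simp_all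
    \<comment> \<open>The triangle equation multiplied by both denominators; its factors apart from
      the last are nonzero.\<close>
    have "(D' - y2 * D') * (x1 * D) + (y1 * D' - y2 * D') * (D + N * (x1 * D) + (a1 - 1 - N) * (x2 * D))
        = (- p * (y1 * D') - (p + h) * (y2 * D')) * (x1 * D)"
      using local[OF a1_pos] unfolding t1 t3 by algebra
    then have "p * ((h - 2 * p) * (h + 2 * p) * (1 + p) * (N * (1 + p) - a1)) = 0"
      unfolding e unfolding D_def D'_def using a1h by algebra
    then show ?thesis using p0 p1 h2p by auto
  qed
  \<comment> \<open>Equality would make the numerator of \<open>x2\<close> or of \<open>y2\<close>
    vanish.\<close>
  have "N \<noteq> p"
  proof
    assume "N = p"
    then have "h\<^sup>2 = (p * (1 + p)) * (p * (1 + p))" using N a1h by simp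
    then have "(h - p - p\<^sup>2) * (- h - p - p\<^sup>2) = 0"
      by (simp add: power2_eq_square algebra_simps)
    then show False using nz2 unfolding X(2) Y(2) by auto
  qed
  then show ?thesis by (rule that[OF p_pos N c2 b3 c3])
qed

section \<open>Exclusion of the structure (0,4,2,3,1)\<close>

context q_poly4
begin

text \<open>The assumptions on \<open>m'\<close> are Leonard's recurrences of the second structure,
  written with the indices of the first.\<close>

lemma no_reversing_structure:
  assumes T: "T 4 4 1 = 0" "T 1 2 2 \<noteq> 0"
    and m': "\<theta> 4 - \<theta> 2 = m' * (\<theta> 0 - \<theta> 3)" "\<theta> 2 - \<theta> 3 = m' * (\<theta> 4 - \<theta> 1)"
      "u 4 1 - u 4 2 = m' * (u 4 0 - u 4 3)" "u 4 2 - u 4 3 = m' * (u 4 1 - u 4 4)"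
  shows False
proof -
  have d: "i \<le> 4 \<Longrightarrow> i \<le> diam" for i using diam4 by simp
  have u0: "u i 0 > 0" if "i \<le> 4" for i using u_0_pos[OF d[OF that]] .
  obtain m where m: "\<theta> 1 - \<theta> 2 = m * (\<theta> 0 - \<theta> 3)" "\<theta> 2 - \<theta> 3 = m * (\<theta> 1 - \<theta> 4)"
    "u 1 1 - u 1 2 = m * (u 1 0 - u 1 3)" "u 1 2 - u 1 3 = m * (u 1 1 - u 1 4)"
    using leonard_recurrence by metis
  define k where "k = real (nbrs 0 1)"
  define x where "x j = u 1 j / u 1 0" for j
  define y where "y j = u 4 j / u 4 0" for j
  have k: "k = \<theta> 0" "1 + real (nbrs 1 1) + real (nbrs 1 2) = k"
    "real (nbrs 2 1) + real (nbrs 2 2) + real (nbrs 2 3) = k"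
    "real (nbrs 3 2) + real (nbrs 3 3) + real (nbrs 3 4) = k"
    using column[of "u 0" "\<theta> 0"] u_recurrence[OF d[of 0] d] unfolding k_def by (simp_all add: u_0)
  note xc = column[of "u 1" "\<theta> 1", OF u_recurrence[OF d d], folded x_def k_def]
  note yc = column[of "u 4" "\<theta> 4", OF u_recurrence[OF d d], folded y_def k_def]
  \<comment> \<open>With equal base points, \<open>product_eigenvector\<close> says that the
    products \<open>u 4 l * u 1 l\<close> satisfy the recurrence for
    \<open>\<theta> 3\<close>.\<close>
  have prod_rec: "(\<Sum>l\<le>diam. real (nbrs h l) * (u 4 l * u 1 l)) = \<theta> 3 * (u 4 h * u 1 h)"
    if h: "h \<le> 4" for h
  proof -
    obtain a b where ab: "dist_G a b = h" using ex_dist d[OF h] by blast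
    show ?thesis
      using product_eigenvector[OF T(1), of a b b] sum_nbrs[OF ab, of "\<lambda>l. u 4 l * u 1 l"]
        e_u[OF d[of 1]] e_u[OF d[of 4]] ab by simp
  qed
  have xy0: "u 4 0 * u 1 0 \<noteq> 0" using u0[of 1] u0[of 4] by simp
  have xyj: "u 4 j * u 1 j / (u 4 0 * u 1 0) = x j * y j" for j unfolding x_def y_def by (simp add: mult.commute)
  note xyc = column[of "\<lambda>j. u 4 j * u 1 j", OF prod_rec xy0, unfolded xyj, folded k_def]
  have x0: "u 1 0 \<noteq> 0" "u 4 0 \<noteq> 0" using u0[of 1] u0[of 4] by simp_all
  have xm: "x 1 - x 2 = m * (1 - x 3)" "x 2 - x 3 = m * (x 1 - x 4)"
    unfolding x_def diff_divide_distrib[symmetric] m using x0 by (simp_all add: field_simps)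
  have ym: "y 1 - y 2 = m' * (1 - y 3)" "y 2 - y 3 = m' * (y 1 - y 4)"
    unfolding y_def diff_divide_distrib[symmetric] m' using x0 by (simp_all add: field_simps)
  have nz2: "x 2 \<noteq> 0" "y 2 \<noteq> 0" using u_2_neq_0[OF T] x0 unfolding x_def y_def by simp_all
  have b1: "nbrs 1 2 > 0" using nbrs_Suc_pos[of 1] diam4 by (simp add: eval_nat_numeral)
  \<comment> \<open>A triangle exists as soon as \<open>a\<^sub>1 > 0\<close>; without one
    \<open>N\<close> is arbitrary. That \<open>a\<^sub>1 > 0\<close> comes out in
    \<open>feasible_parameters\<close>.\<close>
  have ex_local: "\<exists>N. nbrs 1 1 > 0 \<longrightarrow>
      (u 4 0 - u 4 2) * u 1 1 + (u 4 1 - u 4 2) * (u 1 0 + real N * u 1 1 + (real (nbrs 1 1) - 1 - real N) * u 1 2)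
    = (\<theta> 3 * u 4 1 - \<theta> 1 * u 4 2) * u 1 1"
  proof (cases "nbrs 1 1 > 0")
    case True
    obtain a b where ab: "dist_G a b = 1" using ex_dist d[of 1] by (metis one_le_numeral)
    have "{c. adj a c \<and> dist_G c b = 1} \<noteq> {}" using nbrs[OF ab, of 1] True by (metis card.empty less_numeral_extra(3))
    then obtain c where "adj a c" "dist_G c b = 1" by blast
    then show ?thesis using local_count[OF T(1), of b a c] ab gdist_eq_1_iff adj_sym by blast
  qed simp
  then obtain N where N: "nbrs 1 1 > 0 \<longrightarrow>
      (u 4 0 - u 4 2) * u 1 1 + (u 4 1 - u 4 2) * (u 1 0 + real N * u 1 1 + (real (nbrs 1 1) - 1 - real N) * u 1 2)
    = (\<theta> 3 * u 4 1 - \<theta> 1 * u 4 2) * u 1 1" by (rule exE)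
  have local: "(1 - y 2) * x 1 + (y 1 - y 2) * (1 + real N * x 1 + (real (nbrs 1 1) - 1 - real N) * x 2)
      = (\<theta> 3 * y 1 - \<theta> 1 * y 2) * x 1" if "real (nbrs 1 1) > 0"
  proof -
    have f: "u 1 j = u 1 0 * x j" "u 4 j = u 4 0 * y j" for j unfolding x_def y_def using x0 by simp_all
    have "x 0 = 1" "y 0 = 1" unfolding x_def y_def using x0 by simp_all
    then have "(u 4 0 * u 1 0) * ((1 - y 2) * x 1 + (y 1 - y 2) * (1 + real N * x 1 + (real (nbrs 1 1) - 1 - real N) * x 2))
      = (u 4 0 * u 1 0) * ((\<theta> 3 * y 1 - \<theta> 1 * y 2) * x 1)"
      using N that f[of 1] f[of 2] by (simp add: algebra_simps)
    then show ?thesis using xy0 mult_left_cancel by blast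
  qed
  have neq: "\<theta> 1 \<noteq> k" "\<theta> 4 \<noteq> k" "\<theta> 1 \<noteq> \<theta> 2" "\<theta> 1 \<noteq> \<theta> 4" "\<theta> 3 \<noteq> k"
    unfolding k(1) by (simp_all add: \<theta>_neq)
  obtain p where p: "p > 0" "real N * (1 + p) = real (nbrs 1 1)" "real (nbrs 2 1) + p = real (nbrs 1 1)"
    "real (nbrs 2 1) * real (nbrs 3 4) = p * p"
    "real (nbrs 3 2) + real (nbrs 3 4) + p = (1 + p) * real (nbrs 2 1)" "real N \<noteq> p"
    by (rule feasible_parameters[OF k(2-4) _ _ _ _ neq m(1,2)[folded k(1)] m'(1,2)[folded k(1)] xm ym
          xc(1-4) yc(1-4) xyc(1,2) nz2 local])
      (use b1 x0 in auto)
  \<comment> \<open>\<open>p\<close> is a natural number, being positive and the difference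
    \<open>a\<^sub>1 - c\<^sub>2\<close>.\<close>
  define P where "P = nbrs 1 1 - nbrs 2 1"
  have P: "p = real P" unfolding P_def using p(1,3) by (simp add: of_nat_diff)
  show False
  proof (rule no_feasible_array[of N P "nbrs 1 1" "nbrs 2 1" "nbrs 3 4" "nbrs 3 2"])
    show "nbrs 3 2 > 0" using nbrs_pred_pos[of 2] diam4 by (simp add: eval_nat_numeral)
    have "real (N * (1 + P)) = real (nbrs 1 1)" using p(2) unfolding P by (simp add: algebra_simps)
    then show "N * (1 + P) = nbrs 1 1" by (simp only: of_nat_eq_iff)
    have "real (nbrs 2 1 + P) = real (nbrs 1 1)" using p(3) unfolding P by simp
    then show "nbrs 2 1 + P = nbrs 1 1" by (simp only: of_nat_eq_iff)
    have "real (nbrs 2 1 * nbrs 3 4) = real (P * P)" using p(4) unfolding P by simp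
    then show "nbrs 2 1 * nbrs 3 4 = P * P" by (simp only: of_nat_eq_iff)
    have "real (nbrs 3 2 + nbrs 3 4 + P) = real ((1 + P) * nbrs 2 1)" using p(5) unfolding P by (simp add: algebra_simps)
    then show "nbrs 3 2 + nbrs 3 4 + P = (1 + P) * nbrs 2 1" by (simp only: of_nat_eq_iff)
    show "P > 0" "N \<noteq> P" using p(1,6) unfolding P by simp_all
  qed
qed

end

section \<open>Pairs of structures\<close>

context idempotents
begin

text \<open>Expanded in the \<open>E l\<close>, the \<open>F i\<close> have coefficients 0 and 1
  with disjoint nonempty supports. There are as many \<open>F i\<close> as \<open>E l\<close>, so
  every support is a single index.\<close>

lemma ordering_unique:
  assumes "idempotent_ordering adj F"
  obtains \<pi> where "inj_on \<pi> {..diam}" "\<pi> 0 = 0" "\<And>i. i \<le> diam \<Longrightarrow> \<pi> i \<le> diam \<and> F i = E (\<pi> i)"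
proof -
  interpret F: idempotents adj F by unfold_locales (rule assms)
  have "\<exists>c. \<forall>x y. F.u i (dist_G x y) = (\<Sum>l\<le>diam. c l * e l x y)" for i
    using idempotents_span[of "F.u i"] by metis
  then obtain \<beta> where \<beta>: "F.u i (dist_G x y) = (\<Sum>l\<le>diam. \<beta> i l * e l x y)" for i x y by metis
  have Fe: "F.e i x y = (\<Sum>l\<le>diam. \<beta> i l * e l x y)" if "i \<le> diam" for i x y
    using F.e_u[OF that] \<beta> by simp
  have coeff: "c l = d l" if eq: "\<And>x y. (\<Sum>l\<le>diam. c l * e l x y) = (\<Sum>l\<le>diam. d l * e l x y)"
    and l: "l \<le> diam" for c d l
    using sum_e_mult[OF l, of c] sum_e_mult[OF l, of d] M_pos[OF l] unfolding eq by simp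
  have mult: "\<beta> i l * \<beta> j l = (if i = j then \<beta> i l else 0)" if ij: "i \<le> diam" "j \<le> diam" and l: "l \<le> diam" for i j l
  proof (rule coeff[OF _ l])
    fix x y
    have "(\<Sum>l\<le>diam. \<beta> i l * \<beta> j l * e l x y)
        = (\<Sum>l\<le>diam. \<Sum>l'\<le>diam. \<beta> i l * \<beta> j l' * (\<Sum>z\<in>UNIV. e l x z * e l' z y))"
      by (rule sum.cong) (simp_all add: e_mult if_distrib[of "\<lambda>t. _ * t"] cong: if_cong)
    also have "\<dots> = (\<Sum>z\<in>UNIV. F.e i x z * F.e j z y)"
      using sum_e_bilinear[of "\<beta> i" x "\<lambda>_. 1" "\<beta> j" y] by (simp add: Fe ij)
    also have "\<dots> = (\<Sum>l\<le>diam. (if i = j then \<beta> i l else 0) * e l x y)"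
      using F.e_mult[OF ij, of x y] Fe[OF ij(1), of x y] Fe[OF ij(2), of x y] by simp
    finally show "(\<Sum>l\<le>diam. \<beta> i l * \<beta> j l * e l x y) = (\<Sum>l\<le>diam. (if i = j then \<beta> i l else 0) * e l x y)" .
  qed
  have "\<exists>l\<le>diam. \<beta> i l \<noteq> 0" if i: "i \<le> diam" for i
  proof (rule ccontr)
    assume "\<not> (\<exists>l\<le>diam. \<beta> i l \<noteq> 0)"
    then have "F.e i x y = 0" for x y unfolding Fe[OF i] by simp
    then show False using F.E_neq_0[OF i] unfolding F.e_def vec_eq_iff by simp
  qed
  then obtain \<pi> where \<pi>: "\<And>i. i \<le> diam \<Longrightarrow> \<pi> i \<le> diam \<and> \<beta> i (\<pi> i) \<noteq> 0" by metis
  have inj: "inj_on \<pi> {..diam}"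
  proof (rule inj_onI)
    fix i j assume ij: "i \<in> {..diam}" "j \<in> {..diam}" "\<pi> i = \<pi> j"
    then have "\<beta> i (\<pi> i) * \<beta> j (\<pi> i) \<noteq> 0" using \<pi>[of i] \<pi>[of j] by simp
    then show "i = j" using mult[of i j "\<pi> i"] \<pi>[of i] ij by (simp split: if_splits)
  qed
  have surj: "\<pi> ` {..diam} = {..diam}"
    by (rule endo_inj_surj) (use inj \<pi> in auto)
  have F_E: "F.e i x y = e (\<pi> i) x y" if i: "i \<le> diam" for i x y
  proof -
    \<comment> \<open>Some \<open>F j\<close> has \<open>l\<close> in its support; by disjointness
      no other one does.\<close>
    have "\<beta> i l = (if l = \<pi> i then 1 else 0)" if l: "l \<le> diam" for l
    proof -
      obtain j where j: "j \<le> diam" "\<pi> j = l" using surj l by (metis atMost_iff imageE)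
      show ?thesis
        using mult[OF i j(1) l] mult[OF i i l] \<pi>[OF i] \<pi>[OF j(1)] j by (auto split: if_splits)
    qed
    then have "F.e i x y = (\<Sum>l\<le>diam. (if l = \<pi> i then 1 else 0) * e l x y)"
      unfolding Fe[OF i] by simp
    then show ?thesis using \<pi>[OF i] by (simp add: if_distrib[of "\<lambda>t. t * _"] cong: if_cong)
  qed
  \<comment> \<open>Both orderings begin with the same multiple of the all-ones matrix.\<close>
  have "\<pi> 0 = 0"
  proof (rule ccontr)
    assume "\<pi> 0 \<noteq> 0"
    fix x :: 'n
    have "e (\<pi> 0) a b = e 0 a b" for a b using F_E[of 0 a b] by (simp add: F.e_0 e_0)
    then have "u 0 0 = 0"
      using e_mult[of 0 "\<pi> 0" x x] e_mult[of 0 0 x x] \<pi>[of 0] \<open>\<pi> 0 \<noteq> 0\<close> e_u[of 0 x x] by simp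
    then show False using u_0_pos[of 0] by simp
  qed
  moreover have "F i = E (\<pi> i)" if "i \<le> diam" for i
    using F_E[OF that] unfolding F.e_def e_def vec_eq_iff by simp
  ultimately show ?thesis using that inj \<pi> by blast
qed

end

section \<open>Comparison of two structures\<close>

lemma q_poly4I:
  assumes "distance_regular adj" "diameter adj = 4" "Q_polynomial_structure adj E"
  shows "q_poly4 adj E"
proof -
  interpret idempotents adj E
    using assms unfolding Q_polynomial_structure_def by unfold_locales auto
  have K: "(i + j < h \<longrightarrow> T i j h = 0) \<and> (h = i + j \<longrightarrow> T i j h \<noteq> 0)" if "i \<le> diam" "j \<le> diam" "h \<le> diam" for i j h
    using assms(3) that krein_eq_0_iff[OF that] unfolding Q_polynomial_structure_def by blast
  show ?thesis
    by unfold_locales (use K assms(2) in auto)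
qed

lemma (in q_poly4) dual_a_eq_0:
  assumes "T 1 1 1 = 0" "T 1 2 2 = 0"
  shows "dual_a adj E 1 = 0" "dual_a adj E 2 = 0" "dual_a adj E 3 = 0"
  using assms dual_a_2_3_iff krein_eq_0_iff diam4 unfolding dual_a_def by simp_all

text \<open>\<open>T i j h\<close> stands for a nonzero Krein parameter, and
  \<open>[a, b, c, d]\<close> lists the indices of the second structure in terms of the first. The
  statement is a finite check; \<open>[2, 4, 3, 1]\<close> and \<open>[4, 1, 3, 2]\<close> are
  inverse, so they are one case with the roles exchanged.\<close>

lemma relabellings:
  fixes T :: "nat \<Rightarrow> nat \<Rightarrow> nat \<Rightarrow> bool"
  assumes sym: "\<And>i j h. T i j h = T j i h" "\<And>i j h. T i j h = T i h j"
    and E: "\<not> T 1 1 3" "\<not> T 1 1 4" "\<not> T 1 2 4" "T 1 1 2" "T 1 2 3" "T 1 3 4" "T 2 2 4"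
    and F: "\<not> T a a c" "\<not> T a a d" "\<not> T a b d" "T a a b" "T a b c" "T a c d" "T b b d"
    and ran: "a \<in> {1, 2, 3, 4}" "b \<in> {1, 2, 3, 4}" "c \<in> {1, 2, 3, 4}" "d \<in> {1, 2, 3, 4}"
    and dist: "distinct [a, b, c, d]"
  shows "[a, b, c, d] \<in> {[1, 2, 3, 4], [2, 4, 3, 1], [4, 1, 3, 2], [3, 2, 1, 4], [3, 4, 1, 2], [4, 2, 3, 1]}"
proof -
  have S: "T 2 1 1 = T 1 1 2" "T 1 2 1 = T 1 1 2" "T 3 1 1 = T 1 1 3" "T 1 3 1 = T 1 1 3"
    "T 4 1 1 = T 1 1 4" "T 1 4 1 = T 1 1 4" "T 4 2 2 = T 2 2 4" "T 2 4 2 = T 2 2 4"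
    "T 1 3 2 = T 1 2 3" "T 2 1 3 = T 1 2 3" "T 2 3 1 = T 1 2 3" "T 3 1 2 = T 1 2 3" "T 3 2 1 = T 1 2 3"
    "T 1 4 2 = T 1 2 4" "T 2 1 4 = T 1 2 4" "T 2 4 1 = T 1 2 4" "T 4 1 2 = T 1 2 4" "T 4 2 1 = T 1 2 4"
    "T 1 4 3 = T 1 3 4" "T 3 1 4 = T 1 3 4" "T 3 4 1 = T 1 3 4" "T 4 1 3 = T 1 3 4" "T 4 3 1 = T 1 3 4"
    using sym by metis+
  show ?thesis using ran dist F E S by (auto simp del: One_nat_def)
qed

theorem theorem2:
  fixes adj :: "'n::finite \<Rightarrow> 'n \<Rightarrow> bool" and k :: nat
  assumes "distance_regular adj"
    and "diameter adj = 4"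
    and "regular_of_valency adj k" and "k \<ge> 3"
    and "twice_Q_polynomial adj"
  shows "\<exists>E. Q_polynomial_structure adj E \<and>
           dual_a adj E 1 = 0 \<and> dual_a adj E 2 = 0 \<and> dual_a adj E 3 = 0"
proof -
  obtain E F where EF: "Q_polynomial_structure adj E" "Q_polynomial_structure adj F" "E \<noteq> F"
    using assms(5) unfolding twice_Q_polynomial_def card_2_iff by blast
  interpret E: q_poly4 adj E by (rule q_poly4I[OF assms(1,2) EF(1)])
  interpret F: q_poly4 adj F by (rule q_poly4I[OF assms(1,2) EF(2)])
  note diam4 = assms(2)
  obtain \<pi> where inj: "inj_on \<pi> {..diameter adj}" and \<pi>0: "\<pi> 0 = 0"
    and \<pi>: "\<And>i. i \<le> diameter adj \<Longrightarrow> \<pi> i \<le> diameter adj \<and> F i = E (\<pi> i)"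
    using E.ordering_unique[OF F.ord] by blast
  have Fe: "F.e i = E.e (\<pi> i)" if "i \<le> 4" for i
    using \<pi>[of i] that diam4 unfolding F.e_def E.e_def by simp
  have FT: "F.T i j h = E.T (\<pi> i) (\<pi> j) (\<pi> h)" if "i \<le> 4" "j \<le> 4" "h \<le> 4" for i j h
    unfolding F.T_def E.T_def using Fe that by simp
  have Fu: "F.u i = E.u (\<pi> i)" if "i \<le> 4" for i
    unfolding F.u_def E.u_def using Fe[OF that] by simp
  have F\<theta>: "F.\<theta> i = E.\<theta> (\<pi> i)" if "i \<le> 4" for i
    unfolding F.\<theta>_def E.\<theta>_def F.M_def E.M_def using Fe[OF that] by simp
  have range_\<pi>: "\<pi> i \<in> {1, 2, 3, 4}" if i: "1 \<le> i" "i \<le> 4" for i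
  proof -
    have "\<pi> i \<noteq> \<pi> 0" using inj i diam4 by (auto dest: inj_onD[of _ _ i 0])
    then show ?thesis using \<pi>[of i] \<pi>0 i diam4 by auto
  qed
  have E_far: "E.T 1 1 3 = 0" "E.T 1 1 4 = 0" "E.T 1 2 4 = 0"
    using E.T_far[of 1 1 3] E.T_far[of 1 1 4] E.T_far[of 1 2 4] diam4 by simp_all
  have E_sum: "E.T 1 1 2 \<noteq> 0" "E.T 1 2 3 \<noteq> 0" "E.T 1 3 4 \<noteq> 0" "E.T 2 2 4 \<noteq> 0"
    using E.T_sum[of 1 1] E.T_sum[of 1 2] E.T_sum[of 1 3] E.T_sum[of 2 2] diam4
    by (simp_all add: numeral_2_eq_2[symmetric])
  have F_far: "E.T (\<pi> 1) (\<pi> 1) (\<pi> 3) = 0" "E.T (\<pi> 1) (\<pi> 1) (\<pi> 4) = 0" "E.T (\<pi> 1) (\<pi> 2) (\<pi> 4) = 0"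
    using F.T_far[of 1 1 3] F.T_far[of 1 1 4] F.T_far[of 1 2 4] diam4 by (simp_all add: FT)
  have F_sum: "E.T (\<pi> 1) (\<pi> 1) (\<pi> 2) \<noteq> 0" "E.T (\<pi> 1) (\<pi> 2) (\<pi> 3) \<noteq> 0"
    "E.T (\<pi> 1) (\<pi> 3) (\<pi> 4) \<noteq> 0" "E.T (\<pi> 2) (\<pi> 2) (\<pi> 4) \<noteq> 0"
    using F.T_sum[of 1 1] F.T_sum[of 1 2] F.T_sum[of 1 3] F.T_sum[of 2 2] diam4
    by (simp_all add: FT numeral_2_eq_2[symmetric])
  have "distinct [\<pi> 1, \<pi> 2, \<pi> 3, \<pi> 4]"
    using inj diam4 by (auto simp: inj_on_eq_iff)
  then have "[\<pi> 1, \<pi> 2, \<pi> 3, \<pi> 4]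
      \<in> {[1, 2, 3, 4], [2, 4, 3, 1], [4, 1, 3, 2], [3, 2, 1, 4], [3, 4, 1, 2], [4, 2, 3, 1]}"
    using E_far E_sum F_far F_sum
    by (intro relabellings[of "\<lambda>i j h. E.T i j h \<noteq> 0"] range_\<pi>) (simp_all add: E.T_swap12 E.T_swap23)
  then consider "\<pi> 1 = 1" "\<pi> 2 = 2" "\<pi> 3 = 3" "\<pi> 4 = 4" | "\<pi> 1 = 2" "\<pi> 4 = 1" | "\<pi> 1 = 4" "\<pi> 2 = 1"
    | "\<pi> 1 = 3" "\<pi> 3 = 1" | "\<pi> 1 = 4" "\<pi> 2 = 2" "\<pi> 3 = 3" "\<pi> 4 = 1" by auto
  then show ?thesis
  proof cases
    case 1
    have "F i = E i" for i
    proof (cases "i \<le> 4")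
      case True
      then consider "i = 0" | "i = 1" | "i = 2" | "i = 3" | "i = 4" by linarith
      then show ?thesis using \<pi>[of i] True 1 \<pi>0 diam4 by cases simp_all
    next
      case False
      then show ?thesis using E.E_beyond[of i] F.E_beyond[of i] diam4 by simp
    qed
    then show ?thesis using EF(3) by auto
  next
    case 2
    \<comment> \<open>The vanishing parameter (1,1,4) of \<open>F\<close> is the parameter (2,2,1)
      of \<open>E\<close>.\<close>
    have 22: "E.T 1 2 2 = 0" using F_far(2) 2 E.T_swap12 E.T_swap23 by metis
    then have "E.T 1 1 1 = 0"
      using E.dual_a_1_eq_0[of 1] diam4 E.T_swap12[of 2 1 2] by (simp add: numeral_2_eq_2[symmetric])
    then show ?thesis using E.dual_a_eq_0 22 EF(1) by blast
  next
    case 3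
    \<comment> \<open>The same case with \<open>E\<close> and \<open>F\<close> exchanged, so
      \<open>F\<close> is the structure sought.\<close>
    have "F.T 1 2 2 = E.T 4 1 1" using FT[of 1 2 2] 3 by simp
    then have 22: "F.T 1 2 2 = 0" using E_far(2) E.T_swap12 E.T_swap23 by metis
    then have "F.T 1 1 1 = 0"
      using F.dual_a_1_eq_0[of 1] diam4 F.T_swap12[of 2 1 2] by (simp add: numeral_2_eq_2[symmetric])
    then show ?thesis using F.dual_a_eq_0 22 EF(2) by blast
  next
    case 4
    \<comment> \<open>The vanishing parameter (1,1,3) of \<open>F\<close> is (3,3,1) for
      \<open>E\<close>; both relabellings that exchange 1 and 3 or send 1 to 3 and 3 to 1 are
      covered.\<close>
    have 33: "E.T 1 3 3 = 0" using F_far(1) 4 E.T_swap12 E.T_swap23 by metis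
    then have 11: "E.T 1 1 1 = 0"
      using E.dual_a_1_eq_0[of 2] diam4 E.T_swap12[of 3 1 3] by simp
    then have "E.T 1 2 2 = 0" using E.dual_a_2_3_iff 33 by blast
    then show ?thesis using E.dual_a_eq_0 11 EF(1) by blast
  next
    case 5
    \<comment> \<open>Leonard's recurrences for \<open>F\<close>, rewritten in the indices of
      \<open>E\<close>, are the remaining hypotheses of
      \<open>no_reversing_structure\<close>.\<close>
    obtain m where m: "F.\<theta> 1 - F.\<theta> 2 = m * (F.\<theta> 0 - F.\<theta> 3)" "F.\<theta> 2 - F.\<theta> 3 = m * (F.\<theta> 1 - F.\<theta> 4)"
      "F.u 1 1 - F.u 1 2 = m * (F.u 1 0 - F.u 1 3)" "F.u 1 2 - F.u 1 3 = m * (F.u 1 1 - F.u 1 4)"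
      using F.leonard_recurrence by metis
    have F_E: "F.\<theta> 0 = E.\<theta> 0" "F.\<theta> 1 = E.\<theta> 4" "F.\<theta> 2 = E.\<theta> 2" "F.\<theta> 3 = E.\<theta> 3"
      "F.\<theta> 4 = E.\<theta> 1" "F.u 1 = E.u 4"
      using F\<theta>[of 0] F\<theta>[of 1] F\<theta>[of 2] F\<theta>[of 3] F\<theta>[of 4] Fu[of 1] 5 \<pi>0 by simp_all
    have "E.T 4 4 1 = 0" using F_far(2) 5 by simp
    moreover have "E.T 1 2 2 \<noteq> 0" using F_sum(4) 5 E.T_swap12 E.T_swap23 by metis
    ultimately have False by (rule E.no_reversing_structure[OF _ _ m[unfolded F_E]])
    then show ?thesis ..
  qed
qed

end
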